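(* For any given weighted rooted tree $L$, the proportion of weighted rooted trees of total weight $n$ that have $L$ as a limb approaches $1$ as $n\to\infty$.
   Context: A weighted rooted tree is a finite rooted tree in which each vertex is assigned a positive integer weight. Its total weight is the sum of the weights of all its vertices. Weighted rooted trees are counted up to isomorphism preserving the root and the vertex weights; there are finitely many of each total weight $n$. Let $T$ be a weighted rooted tree and $v\in V(T)$. A branch at $v$ is a weighted subtree of $T$, rooted at $v$, consisting of $v$, one child $v'$ of $v$, and all descendants of $v'$ in $T$ (so $v$ has degree $1$ in it), with weights inherited from $T$. A limb at $v$ is a weighted rooted subtree of $T$ with root $v$ that consists of a (possibly empty) collection of branches at $v$. The tree $T$ has $L$ as a limb if for some $v\in V(T)$ there is a limb at $v$ isomorphic to $L$ as a weighted rooted tree. *)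

theory Defs
  imports Complex_Main
begin

text \<open>
  A rooted tree is given by its finite vertex set, its root, and its edges, each edge being
  oriented away from the root: \<open>(u, v) \<in> edges T\<close> means that \<open>v\<close> is a child of \<open>u\<close>.
  The weight function is only relevant on the vertex set.
\<close>

record 'v wrtree =
  verts :: "'v set"
  edges :: "('v \<times> 'v) set"
  root :: 'v
  weight :: "'v \<Rightarrow> nat"

definition weighted_rooted_tree :: "'v wrtree \<Rightarrow> bool" where
  "weighted_rooted_tree T \<longleftrightarrow>
     finite (verts T) \<and> root T \<in> verts T \<and> edges T \<subseteq> verts T \<times> verts T \<and>
     (\<forall>u. (u, root T) \<notin> edges T) \<and>
     (\<forall>v\<in>verts T - {root T}. \<exists>!u. (u, v) \<in> edges T) \<and>
     (\<forall>v\<in>verts T. (root T, v) \<in> (edges T)\<^sup>*) \<and>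
     (\<forall>v\<in>verts T. 0 < weight T v)"

definition total_weight :: "'v wrtree \<Rightarrow> nat" where
  "total_weight T = (\<Sum>v\<in>verts T. weight T v)"

definition isomorphic :: "'v wrtree \<Rightarrow> 'w wrtree \<Rightarrow> bool" where
  "isomorphic S T \<longleftrightarrow>
     (\<exists>f. bij_betw f (verts S) (verts T) \<and> f (root S) = root T \<and>
          (\<forall>u\<in>verts S. \<forall>v\<in>verts S. (u, v) \<in> edges S \<longleftrightarrow> (f u, f v) \<in> edges T) \<and>
          (\<forall>v\<in>verts S. weight T (f v) = weight S v))"

definition children :: "'v wrtree \<Rightarrow> 'v \<Rightarrow> 'v set" where
  "children T v = {c. (v, c) \<in> edges T}"

text \<open>The vertex \<open>v\<close> counts as one of its own descendants here.\<close>

definition descendants :: "'v wrtree \<Rightarrow> 'v \<Rightarrow> 'v set" where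
  "descendants T v = {w. (v, w) \<in> (edges T)\<^sup>*}"

definition branch :: "'v wrtree \<Rightarrow> 'v \<Rightarrow> 'v \<Rightarrow> 'v wrtree" where
  "branch T v c =
     (let V = insert v (descendants T c)
      in \<lparr>verts = V, edges = edges T \<inter> V \<times> V, root = v, weight = weight T\<rparr>)"

text \<open>The limb at \<open>v\<close> consisting of the branches through the children in \<open>C\<close>.\<close>

definition limb :: "'v wrtree \<Rightarrow> 'v \<Rightarrow> 'v set \<Rightarrow> 'v wrtree" where
  "limb T v C =
     \<lparr>verts = insert v (\<Union>c\<in>C. verts (branch T v c)),
      edges = (\<Union>c\<in>C. edges (branch T v c)), root = v, weight = weight T\<rparr>"

definition has_limb :: "'v wrtree \<Rightarrow> 'w wrtree \<Rightarrow> bool" where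
  "has_limb T L \<longleftrightarrow> (\<exists>v\<in>verts T. \<exists>C\<subseteq>children T v. isomorphic (limb T v C) L)"

text \<open>
  Every weighted rooted tree is isomorphic to one whose vertices are natural numbers, so the
  trees up to isomorphism are the isomorphism classes of trees on vertices of type \<^typ>\<open>nat\<close>.
\<close>

definition trees_of_weight :: "nat \<Rightarrow> nat wrtree set" where
  "trees_of_weight n = {T. weighted_rooted_tree T \<and> total_weight T = n}"

definition iso_rel :: "(nat wrtree \<times> nat wrtree) set" where
  "iso_rel = {(S, T). weighted_rooted_tree S \<and> weighted_rooted_tree T \<and> isomorphic S T}"

definition limb_proportion :: "'v wrtree \<Rightarrow> nat \<Rightarrow> real" where
  "limb_proportion L n =
     real (card ({T \<in> trees_of_weight n. has_limb T L} // iso_rel)) /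
     real (card (trees_of_weight n // iso_rel))"

lemma isomorphic_refl: "isomorphic T T"
  unfolding isomorphic_def by (intro exI[of _ id]) auto

lemma isomorphic_sym:
  assumes "isomorphic S T" "root S \<in> verts S"
  shows "isomorphic T S"
proof -
  obtain f where f: "bij_betw f (verts S) (verts T)" "f (root S) = root T"
    and e: "\<And>u v. u \<in> verts S \<Longrightarrow> v \<in> verts S \<Longrightarrow> (u, v) \<in> edges S \<longleftrightarrow> (f u, f v) \<in> edges T"
    and w: "\<And>v. v \<in> verts S \<Longrightarrow> weight T (f v) = weight S v"
    using assms(1) unfolding isomorphic_def by blast
  define g where "g = inv_into (verts S) f"
  have g: "bij_betw g (verts T) (verts S)"
    unfolding g_def by (rule bij_betw_inv_into[OF f(1)])
  have gS: "g v \<in> verts S" if "v \<in> verts T" for v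
    using g that by (rule bij_betw_apply)
  have fg: "f (g v) = v" if "v \<in> verts T" for v
    unfolding g_def using f(1) that by (rule bij_betw_inv_into_right)
  have "g (root T) = root S"
    unfolding g_def f(2)[symmetric] using f(1) assms(2) by (rule bij_betw_inv_into_left)
  then show ?thesis
    unfolding isomorphic_def using g e[OF gS gS] w[OF gS] fg by (intro exI[of _ g]) auto
qed

lemma isomorphic_trans:
  assumes "isomorphic S T" "isomorphic T U"
  shows "isomorphic S U"
proof -
  obtain f where f: "bij_betw f (verts S) (verts T)" "f (root S) = root T"
    and e: "\<And>u v. u \<in> verts S \<Longrightarrow> v \<in> verts S \<Longrightarrow> (u, v) \<in> edges S \<longleftrightarrow> (f u, f v) \<in> edges T"
    and w: "\<And>v. v \<in> verts S \<Longrightarrow> weight T (f v) = weight S v"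
    using assms(1) unfolding isomorphic_def by blast
  obtain g where g: "bij_betw g (verts T) (verts U)" "g (root T) = root U"
    and e': "\<And>u v. u \<in> verts T \<Longrightarrow> v \<in> verts T \<Longrightarrow> (u, v) \<in> edges T \<longleftrightarrow> (g u, g v) \<in> edges U"
    and w': "\<And>v. v \<in> verts T \<Longrightarrow> weight U (g v) = weight T v"
    using assms(2) unfolding isomorphic_def by blast
  have fT: "f v \<in> verts T" if "v \<in> verts S" for v
    using f(1) that by (rule bij_betw_apply)
  have "bij_betw (g \<circ> f) (verts S) (verts U)"
    using f(1) g(1) by (rule bij_betw_trans)
  then show ?thesis
    unfolding isomorphic_def using f g e e' w w' fT by (intro exI[of _ "g \<circ> f"]) auto
qed

lemma equiv_iso_rel: "equiv (Collect weighted_rooted_tree) iso_rel"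
proof (rule equivI)
  show "iso_rel \<subseteq> Collect weighted_rooted_tree \<times> Collect weighted_rooted_tree"
    by (auto simp: iso_rel_def)
  show "refl_on (Collect weighted_rooted_tree) iso_rel"
    by (auto simp: refl_on_def iso_rel_def isomorphic_refl)
  show "sym iso_rel"
    by (auto simp: sym_def iso_rel_def weighted_rooted_tree_def intro: isomorphic_sym)
  show "trans iso_rel"
    by (auto simp: trans_def iso_rel_def intro: isomorphic_trans)
qed

text \<open>There are finitely many trees of each total weight, so the cardinalities are genuine.\<close>

lemma iso_to_initial_segment:
  assumes "T \<in> trees_of_weight n"
  shows "\<exists>S. isomorphic T S \<and> verts S \<in> Pow {..<n} \<and> edges S \<in> Pow ({..<n} \<times> {..<n}) \<and>
             root S \<in> {..<n} \<and> weight S \<in> {h. \<forall>v. (v \<in> {..<n} \<longrightarrow> h v \<in> {..n}) \<and> (v \<notin> {..<n} \<longrightarrow> h v = 0)}"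
proof -
  have fin: "finite (verts T)" and rt: "root T \<in> verts T"
    and ed: "edges T \<subseteq> verts T \<times> verts T" and pos: "\<And>v. v \<in> verts T \<Longrightarrow> 0 < weight T v"
    and tot: "(\<Sum>v\<in>verts T. weight T v) = n"
    using assms by (auto simp: trees_of_weight_def weighted_rooted_tree_def total_weight_def)
  define m where "m = card (verts T)"
  have "m = (\<Sum>v\<in>verts T. 1)" by (simp add: m_def)
  also have "\<dots> \<le> n" unfolding tot[symmetric] by (intro sum_mono) (use pos in force)
  finally have mn: "m \<le> n" .
  have wn: "weight T v \<le> n" if "v \<in> verts T" for v
    unfolding tot[symmetric] using fin that by (intro member_le_sum) auto
  obtain f where f: "bij_betw f (verts T) {..<m}"
    using ex_bij_betw_finite_nat[OF fin] by (auto simp: m_def atLeast0LessThan)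
  define g where "g = inv_into (verts T) f"
  have gf: "g (f v) = v" if "v \<in> verts T" for v
    unfolding g_def using f that by (rule bij_betw_inv_into_left)
  have fm: "f v < m" if "v \<in> verts T" for v
    using bij_betw_apply[OF f that] by simp
  have gT: "g i \<in> verts T" if "i < m" for i
    unfolding g_def using bij_betw_inv_into[OF f] that bij_betw_apply by fastforce
  define S where "S = \<lparr>verts = {..<m}, edges = map_prod f f ` edges T, root = f (root T),
    weight = (\<lambda>i. if i < m then weight T (g i) else 0)\<rparr>"
  have "(u, v) \<in> edges T \<longleftrightarrow> (f u, f v) \<in> edges S" if "u \<in> verts T" "v \<in> verts T" for u v
  proof
    assume "(f u, f v) \<in> edges S"
    then obtain u' v' where *: "(u', v') \<in> edges T" "f u = f u'" "f v = f v'"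
      by (auto simp: S_def)
    then have "u' = u" "v' = v" using ed that gf by (metis mem_Sigma_iff subsetD)+
    with * show "(u, v) \<in> edges T" by simp
  qed (force simp: S_def)
  then have "isomorphic T S"
    unfolding isomorphic_def using f gf fm by (intro exI[of _ f]) (auto simp: S_def)
  moreover have "edges S \<subseteq> {..<n} \<times> {..<n}"
    using ed fm mn by (force simp: S_def)
  ultimately show ?thesis
    using mn fm[OF rt] wn gT by (intro exI[of _ S]) (auto simp: S_def)
qed

lemma finite_trees_of_weight: "finite (trees_of_weight n // iso_rel)"
proof -
  define W where "W = {h :: nat \<Rightarrow> nat. \<forall>v. (v \<in> {..<n} \<longrightarrow> h v \<in> {..n}) \<and> (v \<notin> {..<n} \<longrightarrow> h v = 0)}"
  define K where "K = (\<lambda>(V, E, r, w). \<lparr>verts = V, edges = E, root = r, weight = w\<rparr>) `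
    (Pow {..<n} \<times> Pow ({..<n} \<times> {..<n}) \<times> {..<n} \<times> W)"
  have "finite W" unfolding W_def by (rule finite_set_of_finite_funs) auto
  then have "finite K" unfolding K_def by (intro finite_imageI finite_cartesian_product) auto
  moreover have "trees_of_weight n // iso_rel \<subseteq>
      (\<lambda>S. {T. weighted_rooted_tree T \<and> isomorphic T S}) ` K"
  proof
    fix c assume "c \<in> trees_of_weight n // iso_rel"
    then obtain T where T: "T \<in> trees_of_weight n" and c: "c = iso_rel `` {T}"
      by (auto elim: quotientE)
    obtain S where iso: "isomorphic T S" and "verts S \<in> Pow {..<n}"
      "edges S \<in> Pow ({..<n} \<times> {..<n})" "root S \<in> {..<n}" "weight S \<in> W"
      using iso_to_initial_segment[OF T] unfolding W_def by blast
    then have "S \<in> K"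
      unfolding K_def by (intro image_eqI[of _ _ "(verts S, edges S, root S, weight S)"]) auto
    moreover have wT: "weighted_rooted_tree T" using T by (simp add: trees_of_weight_def)
    have "isomorphic T T' \<longleftrightarrow> isomorphic T' S" if "weighted_rooted_tree T'" for T'
      using wT that iso isomorphic_sym isomorphic_trans unfolding weighted_rooted_tree_def
      by meson
    then have "c = {T'. weighted_rooted_tree T' \<and> isomorphic T' S}"
      unfolding c using wT by (auto simp: iso_rel_def)
    ultimately show "c \<in> (\<lambda>S. {T. weighted_rooted_tree T \<and> isomorphic T S}) ` K" by blast
  qed
  ultimately show ?thesis by (rule finite_surj)
qed

end

theory Submission
  imports Defs "HOL-Analysis.Analysis"
begin

text \<open>
  Let \<open>a\<^sub>n\<close>, \<open>f\<^sub>n\<close> and \<open>d\<^sub>n\<close> count, up to isomorphism, the trees avoiding \<open>L\<close>, the forests of such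
  trees, and the trees having \<open>L\<close> as a limb, and let \<open>l\<close> be the total weight of \<open>L\<close>. A tree whose
  branches all avoid \<open>L\<close> fails to avoid \<open>L\<close> only if \<open>L\<close> is a limb at its root, which gives
  \<open>A(x) = w(x) F(x)\<close> with \<open>w(x) = x/(1 - x) - x\<^sup>l\<close> and \<open>F(x) = \<Prod>\<^sub>j (1 - x\<^sup>j)\<close> to the power \<open>-a\<^sub>j\<close>, that is
  \<open>A = w \<cdot> exp H \<cdot> exp A\<close> where \<open>H\<close> converges beyond the radius of convergence \<open>r\<close> of \<open>A\<close>.
  If \<open>A(r) < 1\<close>, then \<open>w(r) exp (H(r)) < 1/e\<close>; this persists slightly to the right of \<open>r\<close>, where the
  partial sums of \<open>A\<close> then stay below 1 by induction, a contradiction. Hence \<open>A(r) \<ge> 1\<close>,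
  and \<open>A(s) + s\<^sup>l \<ge> 1\<close> already for some \<open>s < r\<close>.

  Attaching a tree having \<open>L\<close> as a new branch at the root of \<open>L\<close> or of a tree avoiding \<open>L\<close>
  can be undone, since the new branch is the only one having \<open>L\<close>. So
  \<open>d\<^sub>n \<ge> d\<^bsub>n-l\<^esub> + \<Sum>\<^sub>j a\<^sub>j d\<^bsub>n-j\<^esub>\<close>, which forces \<open>d\<^sub>n\<close> to grow at least like \<open>s\<close> to the power \<open>-n\<close>,
  exponentially faster than \<open>a\<^sub>n\<close>.
\<close>

section \<open>Generating functions\<close>

text \<open>Both bounds are \<open>ln t \<le> t - 1\<close>, at \<open>t = 1 - y\<close> and at
  \<open>t = inverse (1 - y)\<close>. The quadratic upper bound is what lets the correction H
  converge beyond the radius of A.\<close>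

lemma log_remainder_bounds:
  fixes y q :: real
  assumes "0 \<le> y" "y \<le> q" "q < 1"
  shows "0 \<le> - ln (1 - y) - y" "- ln (1 - y) - y \<le> y\<^sup>2 / (1 - q)"
proof -
  show "0 \<le> - ln (1 - y) - y" using ln_le_minus_one[of "1 - y"] assms by simp
  have "- ln (1 - y) = ln (inverse (1 - y))" using assms by (simp add: ln_inverse)
  also have "\<dots> \<le> inverse (1 - y) - 1" using assms by (intro ln_le_minus_one) simp
  finally have "- ln (1 - y) - y \<le> inverse (1 - y) - 1 - y" by simp
  also have "\<dots> = y\<^sup>2 / (1 - y)" using assms by (simp add: field_simps power2_eq_square)
  also have "\<dots> \<le> y\<^sup>2 / (1 - q)" using assms by (intro divide_left_mono) auto
  finally show "- ln (1 - y) - y \<le> y\<^sup>2 / (1 - q)" .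
qed

text \<open>Separates the analysis from the combinatorics. The two Euler assumptions are finite
  forms of the product formula for F: the upper one truncates both sides and so asks for no
  convergence, the lower one compares finite products with a convergent series.\<close>

locale limb_free_gf =
  fixes a f :: "nat \<Rightarrow> nat" and l :: nat
  assumes l_pos: "l > 0"
    and a_eq: "\<And>n. a n = (\<Sum>k\<in>{1..n} - {l}. f (n - k))"
    and f_0: "f 0 = 1"
    and euler_upper: "\<And>x m. 0 < x \<Longrightarrow> x < 1 \<Longrightarrow>
      (\<Sum>i\<le>m. real (f i) * x ^ i) \<le> exp (\<Sum>j\<le>m. real (a j) * - ln (1 - x ^ j))"
    and euler_lower: "\<And>x m. 0 < x \<Longrightarrow> x < 1 \<Longrightarrow> summable (\<lambda>i. real (f i) * x ^ i) \<Longrightarrow>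
      exp (\<Sum>j\<le>m. real (a j) * - ln (1 - x ^ j)) \<le> (\<Sum>i. real (f i) * x ^ i)"
begin

definition S :: "nat \<Rightarrow> real \<Rightarrow> real" where "S m x = (\<Sum>j\<le>m. real (a j) * x ^ j)"
text \<open>Truncates the sum over i >= 2 of A(x^i)/i, the part of log F that involves A only at
  higher powers of x.\<close>

definition H :: "nat \<Rightarrow> real \<Rightarrow> real" where
  "H m x = (\<Sum>j\<le>m. real (a j) * (- ln (1 - x ^ j) - x ^ j))"
definition w :: "real \<Rightarrow> real" where "w x = x / (1 - x) - x ^ l"
text \<open>The coefficient sequence of the power series \<open>w\<close>, so that \<open>a\<close>
  is the convolution of \<open>g\<close> with \<open>f\<close>.\<close>

definition g :: "nat \<Rightarrow> real" where "g k = (if k = 0 \<or> k = l then 0 else 1)"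

lemma a_0: "a 0 = 0" by (simp add: a_eq)

lemma a_conv: "real (a n) = (\<Sum>k\<le>n. g k * real (f (n - k)))"
proof -
  have "real (a n) = (\<Sum>k\<in>{1..n} - {l}. g k * real (f (n - k)))"
    unfolding a_eq of_nat_sum by (intro sum.cong) (auto simp: g_def)
  also have "\<dots> = (\<Sum>k\<le>n. g k * real (f (n - k)))"
    by (intro sum.mono_neutral_left) (auto simp: g_def)
  finally show ?thesis .
qed

lemma exp_S_H: "exp (\<Sum>j\<le>m. real (a j) * - ln (1 - x ^ j)) = exp (S m x + H m x)"
  unfolding S_def H_def sum.distrib[symmetric] by (simp add: algebra_simps)

lemma w_sums: 
  assumes "0 < x" "x < 1" shows "(\<lambda>k. g k * x ^ k) sums w x"
proof -
  have "(\<lambda>k. x * x ^ k) sums (x * (1 / (1 - x)))"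
    using assms by (intro sums_mult geometric_sums) auto
  then have "(\<lambda>k. (if k = 0 then 0 else x ^ k)) sums (x / (1 - x))"
    using sums_Suc_iff[of "\<lambda>k. if k = 0 then 0 else x ^ k"] by simp
  moreover have "(\<lambda>k. if k = l then x ^ k else 0) sums x ^ l"
    using sums_single[of l "\<lambda>k. x ^ k"] by simp
  ultimately have "(\<lambda>k. (if k = 0 then 0 else x ^ k) - (if k = l then x ^ k else 0)) sums w x"
    unfolding w_def by (rule sums_diff)
  then show ?thesis
    by (rule sums_cong[THEN iffD1, rotated]) (use l_pos in \<open>auto simp: g_def\<close>)
qed

lemma w_nonneg: assumes "0 < x" "x < 1" shows "0 \<le> w x"
  using sums_le[OF _ sums_zero w_sums[OF assms]] assms by (auto simp: g_def)

text \<open>Truncation of A = w F: since \<open>g 0 = 0\<close>, the coefficients of A up to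
  \<open>Suc m\<close> use those of F only up to \<open>m\<close>, and enlarging the index triangle
  to a rectangle adds nonnegative terms. The shift by one index drives the inductions on
  \<open>m\<close> below.\<close>

lemma S_Suc_le:
  assumes x: "0 < x" "x < 1"
  shows "S (Suc m) x \<le> w x * (\<Sum>i\<le>m. real (f i) * x ^ i)"
proof -
  let ?F = "\<lambda>(k, i). (g k * x ^ k) * (real (f i) * x ^ i)"
  define D where "D = (SIGMA n:{..Suc m}. {1..n})"
  have "S (Suc m) x = (\<Sum>n\<le>Suc m. \<Sum>k=1..n. g k * real (f (n - k)) * x ^ n)"
    unfolding S_def a_conv sum_distrib_right
    by (intro sum.cong refl sum.mono_neutral_right) (auto simp: g_def)
  also have "\<dots> = (\<Sum>(n, k)\<in>D. g k * real (f (n - k)) * x ^ n)"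
    unfolding D_def by (intro sum.Sigma) auto
  also have "\<dots> = (\<Sum>p\<in>D. ?F (snd p, fst p - snd p))"
    by (intro sum.cong) (auto simp: D_def simp flip: power_add)
  also have "\<dots> = sum ?F ((\<lambda>p. (snd p, fst p - snd p)) ` D)"
    by (subst sum.reindex) (auto simp: D_def inj_on_def)
  also have "\<dots> \<le> sum ?F ({..Suc m} \<times> {..m})"
    by (intro sum_mono2) (use x in \<open>auto simp: D_def g_def\<close>)
  also have "\<dots> = (\<Sum>k\<le>Suc m. g k * x ^ k) * (\<Sum>i\<le>m. real (f i) * x ^ i)"
    by (simp only: sum_product sum.cartesian_product)
  also have "\<dots> \<le> w x * (\<Sum>i\<le>m. real (f i) * x ^ i)"
    unfolding sums_unique[OF w_sums[OF x]]
    by (intro mult_right_mono sum_le_suminf sums_summable[OF w_sums[OF x]] sum_nonneg)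
      (use x in \<open>auto simp: g_def\<close>)
  finally show ?thesis .
qed

lemma S_Suc_le_exp:
  assumes x: "0 < x" "x < 1"
  shows "S (Suc m) x \<le> w x * exp (S m x + H m x)"
  using S_Suc_le[OF x, of m] mult_left_mono[OF euler_upper[OF x, of m] w_nonneg[OF x]]
  unfolding exp_S_H by linarith

text \<open>Once a partial sum is at most 1, the next one is at most
  \<open>exp (-1) * exp 1\<close>. This bounds A at points where its convergence is not known
  beforehand.\<close>

lemma S_le_1:
  assumes x: "0 < x" "x < 1" and "\<And>m. w x * exp (H m x) \<le> exp (-1)"
  shows "S m x \<le> 1"
proof (induction m)
  case (Suc m)
  have "S (Suc m) x \<le> (w x * exp (H m x)) * exp (S m x)"
    using S_Suc_le_exp[OF x, of m] by (simp add: exp_add mult_ac)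
  also have "\<dots> \<le> exp (-1) * exp 1"
    by (intro mult_mono assms(3)) (use Suc in auto)
  finally show ?case by (simp flip: exp_add)
qed (simp add: S_def a_0)

text \<open>For \<open>j > 0\<close> the remainder is quadratic in \<open>x ^ j\<close>. If
  \<open>q\<^sup>2\<close> is a point where A converges, this majorises the terms of H by those of
  A, uniformly in \<open>x \<le> q\<close>.\<close>

lemma H_term_bounds:
  assumes "0 < x" "x \<le> q" "q < 1"
  shows "0 \<le> real (a j) * (- ln (1 - x ^ j) - x ^ j)"
    "real (a j) * (- ln (1 - x ^ j) - x ^ j) \<le> real (a j) * (q\<^sup>2) ^ j / (1 - q)"
proof -
  have "0 \<le> real (a j) * (- ln (1 - x ^ j) - x ^ j) \<and>
    real (a j) * (- ln (1 - x ^ j) - x ^ j) \<le> real (a j) * (q\<^sup>2) ^ j / (1 - q)"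
  proof (cases "j = 0")
    case False
    then have xq: "x ^ j \<le> q"
      using assms power_decreasing[of 1 j x] by simp
    have "(x ^ j)\<^sup>2 \<le> (q ^ j)\<^sup>2" using assms by (intro power_mono) auto
    then have "(x ^ j)\<^sup>2 / (1 - q) \<le> (q\<^sup>2) ^ j / (1 - q)" 
      using assms by (intro divide_right_mono) (auto simp flip: power_mult simp: mult.commute)
    then have "- ln (1 - x ^ j) - x ^ j \<le> (q\<^sup>2) ^ j / (1 - q)" "0 \<le> - ln (1 - x ^ j) - x ^ j"
      using log_remainder_bounds[OF _ xq] assms by force+
    from mult_left_mono[OF this(1), of "real (a j)"] this(2) show ?thesis by simp
  qed (simp add: a_0)
  then show "0 \<le> real (a j) * (- ln (1 - x ^ j) - x ^ j)"
    "real (a j) * (- ln (1 - x ^ j) - x ^ j) \<le> real (a j) * (q\<^sup>2) ^ j / (1 - q)" by auto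
qed

text \<open>Ensures a positive radius of convergence. At 1/16 the sum \<open>H m\<close> is at most
  \<open>S m\<close>, so the induction closes with \<open>w (1/16) \<le> 1/15\<close> and
  \<open>exp 2 \<le> 9\<close>.\<close>

lemma S_small: "S m (1/16) \<le> 1"
proof (induction m)
  case (Suc m)
  have "H m (1/16) \<le> (\<Sum>j\<le>m. real (a j) * (1/16) ^ j)"
    unfolding H_def
  proof (intro sum_mono)
    fix j
    have "real (a j) * ((1/16)\<^sup>2) ^ j / (1 - 1/16) \<le> real (a j) * (1/16) ^ j"
    proof (cases "j = 0")
      case False
      have "((1/16::real)\<^sup>2) ^ j = (1/16) ^ j * (1/16) ^ j"
        by (simp only: power2_eq_square power_mult_distrib)
      also have "\<dots> \<le> (1/16) ^ j * (1/16)"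
        using False power_decreasing[of 1 j "1/16::real"] by (intro mult_left_mono) auto
      finally have "((1/16::real)\<^sup>2) ^ j \<le> (1/16) ^ j * (15/16)" using zero_le_power[of "1/16::real" j] by linarith
      then have "real (a j) * ((1/16::real)\<^sup>2) ^ j \<le> real (a j) * ((1/16) ^ j * (15/16))"
        by (intro mult_left_mono) auto
      then show ?thesis by (simp add: field_simps)
    qed (simp add: a_0)
    then show "real (a j) * (- ln (1 - (1/16) ^ j) - (1/16) ^ j) \<le> real (a j) * (1/16) ^ j"
      using H_term_bounds(2)[of "1/16" "1/16" j] by linarith
  qed
  then have "exp (S m (1/16) + H m (1/16)) \<le> exp (1 + 1)"
    using Suc by (simp add: S_def)
  also have "\<dots> \<le> 3 * 3" unfolding exp_add by (intro mult_mono exp_le) auto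
  finally have "w (1/16) * exp (S m (1/16) + H m (1/16)) \<le> (1/15) * 9"
    using w_nonneg[of "1/16"] by (intro mult_mono) (auto simp: w_def)
  with S_Suc_le_exp[of "1/16" m] show ?case by simp
qed (simp add: S_def a_0)

section \<open>Behaviour of the series at its radius of convergence\<close>

text \<open>A single summand of \<open>a_eq\<close> suffices, for a root weight \<open>k\<close>
  different from \<open>l\<close>. Hence F converges wherever A does.\<close>

lemma f_le_a: "\<exists>k0. \<forall>i. f i \<le> a (i + k0)"
proof (intro exI allI)
  fix i
  let ?k = "if l = 1 then 2 else 1"
  have "f (i + ?k - ?k) \<le> a (i + ?k)"
    unfolding a_eq by (rule member_le_sum[where f = "\<lambda>k. f (i + ?k - k)"]) auto
  then show "f i \<le> a (i + ?k)" by simp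
qed

text \<open>Write A for A(r). The functional equation and \<open>euler_lower\<close> bound w(r)
  exp(H(r)) by A exp(-A), which is below 1/e because A < 1. By continuity the bound 1/e persists
  slightly to the right of \<open>r\<close>, where \<open>S_le_1\<close> applies.\<close>

lemma converges_beyond:
  assumes r: "0 < r" "r < 1" and bound: "\<And>m. S m r \<le> \<alpha>" and "\<alpha> < 1"
  shows "\<exists>x. r < x \<and> x < 1 \<and> (\<forall>m. S m x \<le> 1)"
proof -
  \<comment> \<open>With \<open>q\<^sup>2 = r\<close> the convergent series for A at
    \<open>r\<close> majorises H on all of \<open>{r..q}\<close>.\<close>
  define q where "q = sqrt r"
  have q: "r < q" "q < 1" "q\<^sup>2 = r" "0 < q"
    using r by (auto simp: q_def real_less_rsqrt power2_eq_square)
  have suma: "summable (\<lambda>j. real (a j) * r ^ j)"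
    using bound r unfolding S_def
    by (intro bounded_imp_summable[where B = \<alpha>]) auto
  define A where "A = (\<Sum>j. real (a j) * r ^ j)"
  have "A \<le> \<alpha>" unfolding A_def using bound
    unfolding S_def by (intro LIMSEQ_le_const2[OF summable_LIMSEQ'[OF suma]]) auto
  then have A1: "A < 1" using assms by simp
  have limS: "(\<lambda>m. S m r) \<longlonglongrightarrow> A"
    unfolding S_def A_def by (rule summable_LIMSEQ'[OF suma])
  obtain k0 where k0: "\<And>i. f i \<le> a (i + k0)" using f_le_a by blast
  have sumf: "summable (\<lambda>i. real (f i) * r ^ i)"
  proof (rule summable_comparison_test)
    show "summable (\<lambda>i. (real (a (i + k0)) * r ^ (i + k0)) / r ^ k0)"
      using summable_ignore_initial_segment[OF suma] by (rule summable_divide)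
    show "\<exists>N. \<forall>n\<ge>N. norm (real (f n) * r ^ n) \<le> (real (a (n + k0)) * r ^ (n + k0)) / r ^ k0"
      using k0 r by (auto simp: power_add)
  qed
  have "(\<lambda>n. \<Sum>k\<le>n. (g k * r ^ k) * (real (f (n - k)) * r ^ (n - k))) sums
      ((\<Sum>k. g k * r ^ k) * (\<Sum>i. real (f i) * r ^ i))"
  proof (rule Cauchy_product_sums)
    show "summable (\<lambda>k. norm (g k * r ^ k))"
      using sums_summable[OF w_sums[OF r]] r by (simp add: g_def if_distrib cong: if_cong)
    show "summable (\<lambda>k. norm (real (f k) * r ^ k))" using sumf r by simp
  qed
  also have "(\<lambda>n. \<Sum>k\<le>n. (g k * r ^ k) * (real (f (n - k)) * r ^ (n - k))) =
      (\<lambda>n. real (a n) * r ^ n)"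
    unfolding a_conv sum_distrib_right
    by (intro ext sum.cong) (auto simp flip: power_add)
  finally have A_eq: "A = w r * (\<Sum>i. real (f i) * r ^ i)"
    unfolding A_def using sums_unique w_sums[OF r] by metis

  define h where "h = (\<lambda>j x. real (a j) * (- ln (1 - x ^ j) - x ^ j))"
  have h0: "0 \<le> h j x" and h1: "h j x \<le> real (a j) * r ^ j / (1 - q)"
    if "x \<in> {r..q}" for j x
    using H_term_bounds[of x q j] that q r by (auto simp: h_def)
  have sumM: "summable (\<lambda>j. real (a j) * r ^ j / (1 - q))"
    using suma by (rule summable_divide)
  have sumh: "summable (\<lambda>j. h j x)" if "x \<in> {r..q}" for x
    using h0[OF that] h1[OF that] by (intro summable_comparison_test[OF _ sumM]) auto
  have ulim: "uniform_limit {r..q} (\<lambda>n x. \<Sum>j<n. h j x) (\<lambda>x. \<Sum>j. h j x) sequentially"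
    using h0 h1 by (intro Weierstrass_m_test[OF _ sumM]) auto
  have conth: "continuous_on {r..q} (\<lambda>x. \<Sum>j. h j x)"
  proof -
    have "x ^ j < 1" if "x \<in> {r..q}" "j \<noteq> 0" for x j
      using that q r by (intro power_less_one_iff[THEN iffD2]) auto
    then have pos: "1 - x ^ j > 0" if "x \<in> {r..q}" "j \<noteq> 0" for x j
      using that by simp
    have ch: "continuous_on {r..q} (h j)" for j
    proof (cases "j = 0")
      case True
      then show ?thesis by (simp add: h_def a_0)
    next
      case False
      then show ?thesis unfolding h_def
        by (intro continuous_intros ballI less_imp_neq[THEN not_sym] pos) (use False in auto)
    qed
    have "continuous_on {r..q} (\<lambda>x. \<Sum>j<n. h j x)" for n
      by (rule continuous_on_sum) (rule ch)
    then have "\<forall>\<^sub>F n in sequentially. continuous_on {r..q} (\<lambda>x. \<Sum>j<n. h j x)"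
      by simp
    from uniform_limit_theorem[OF this ulim trivial_limit_sequentially] show ?thesis .
  qed
  \<comment> \<open>\<open>S_le_1\<close> asks exactly that this function, with H truncated, be at
    most \<open>exp (-1)\<close>.\<close>
  define G where "G = (\<lambda>x. w x * exp (\<Sum>j. h j x))"
  have "continuous_on {r..q} G"
    unfolding G_def w_def using q r by (intro continuous_intros conth) auto
  moreover have "G r < exp (-1)"
  proof -
    have "w r * exp (S m r + H m r) \<le> A" for m
      unfolding A_eq using euler_lower[OF r sumf, of m] w_nonneg[OF r]
      unfolding exp_S_H by (rule mult_left_mono)
    moreover have "(\<lambda>m. w r * exp (S m r + H m r)) \<longlonglongrightarrow> w r * exp (A + (\<Sum>j. h j r))"
    proof (intro tendsto_intros limS)
      show "(\<lambda>m. H m r) \<longlonglongrightarrow> (\<Sum>j. h j r)"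
        unfolding H_def h_def
        by (rule summable_LIMSEQ'[OF sumh[of r, unfolded h_def]]) (use q in auto)
    qed
    ultimately have "w r * exp (A + (\<Sum>j. h j r)) \<le> A"
      by (intro LIMSEQ_le_const2) auto
    then have "G r \<le> A * exp (- A)" unfolding G_def
      by (simp add: exp_add exp_minus field_simps)
    \<comment> \<open>The tangent inequality for exp is strict away from its point of contact A =
      1.\<close>
    moreover have "A < exp (A - 1)"
    proof -
      have "exp (A - 1) \<noteq> A"
        using A1 ln_eq_minus_one[of "exp (A - 1)"] by auto
      then show ?thesis using exp_ge_add_one_self[of "A - 1"] by linarith
    qed
    then have "A * exp (- A) < exp (A - 1) * exp (- A)" by simp
    ultimately show ?thesis by (simp flip: exp_add)
  qed
  ultimately have "eventually (\<lambda>x. G x < exp (-1)) (at r within {r..q})"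
    using q by (intro order_tendstoD(2)[where y = "G r"]) (auto simp: continuous_on_def)
  then obtain x where x: "r < x" "x < q" "G x < exp (-1)"
  proof -
    assume *: "\<And>x. r < x \<Longrightarrow> x < q \<Longrightarrow> G x < exp (-1) \<Longrightarrow> thesis"
    assume "eventually (\<lambda>x. G x < exp (-1)) (at r within {r..q})"
    then have "eventually (\<lambda>x. G x < exp (-1)) (at_right r)"
      using q by (simp add: at_within_Icc_at_right)
    then obtain b where "b > r" "\<And>y. r < y \<Longrightarrow> y < b \<Longrightarrow> G y < exp (-1)"
      unfolding eventually_at_right_field by blast
    then show thesis using q *[of "(r + min b q) / 2"] by (auto simp: min_def field_simps)
  qed
  have x01: "0 < x" "x < 1" and xi: "x \<in> {r..q}" using x r q by auto
  have "w x * exp (H m x) \<le> exp (-1)" for m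
  proof -
    have "H m x \<le> (\<Sum>j. h j x)"
      unfolding H_def h_def[symmetric] using h0[OF xi] sumh[OF xi]
      by (simp add: h_def sum_le_suminf)
    then have "w x * exp (H m x) \<le> G x"
      unfolding G_def by (intro mult_left_mono w_nonneg[OF x01]) auto
    then show ?thesis using x by simp
  qed
  then show ?thesis using S_le_1[OF x01] x x01 by blast
qed

text \<open>If all \<open>S N r + r ^ l\<close> were at most 1 at the supremum \<open>r\<close> of
  the convergence points, A would be at most \<open>1 - r ^ l < 1\<close> there and
  \<open>converges_beyond\<close> would contradict the supremum. So some truncation exceeds 1 at
  \<open>r\<close>, and being a polynomial it still does at some \<open>s\<close> below
  \<open>r\<close>.\<close>

lemma growth_gap:
  "\<exists>s r N. 0 < s \<and> s < r \<and> (\<exists>B. \<forall>n. real (a n) * r ^ n \<le> B) \<and> 1 \<le> S N s + s ^ l"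
proof -
  define X where "X = {x. 0 < x \<and> x < 1 \<and> (\<exists>B. \<forall>m. S m x \<le> B)}"
  define r where "r = Sup X"
  have X16: "1/16 \<in> X" using S_small by (auto simp: X_def)
  have bdd: "bdd_above X" by (rule bdd_aboveI[of _ 1]) (auto simp: X_def)
  have r: "0 < r" "r \<le> 1"
  proof -
    have "1/16 \<le> r" unfolding r_def by (rule cSup_upper[OF X16 bdd])
    then show "0 < r" by simp
    have "X \<noteq> {}" using X16 by blast
    moreover have "\<And>x. x \<in> X \<Longrightarrow> x \<le> 1" by (simp add: X_def)
    ultimately show "r \<le> 1" unfolding r_def by (rule cSup_least)
  qed
  have "\<exists>N. S N r + r ^ l > 1"
  proof (rule ccontr)
    assume "\<not> ?thesis"
    then have le: "\<And>N. S N r \<le> 1 - r ^ l" by (simp add: not_less le_diff_eq)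
    \<comment> \<open>At 1 a single nonzero coefficient makes some \<open>S k0 r\<close> at least 1,
      while \<open>1 - r ^ l\<close> would be 0.\<close>
    have "r \<noteq> 1"
    proof
      assume "r = 1"
      obtain k0 where "f 0 \<le> a (0 + k0)" using f_le_a by blast
      then have "1 \<le> real (a k0)" using f_0 by simp
      also have "\<dots> \<le> S k0 r" unfolding S_def \<open>r = 1\<close>
        using member_le_sum[of k0 "{..k0}" "\<lambda>j. real (a j)"] by simp
      finally show False using le[of k0] r \<open>r = 1\<close> by simp
    qed
    then have "r < 1" using r by simp
    moreover have "1 - r ^ l < 1" using r by simp
    ultimately obtain x where "r < x" "x < 1" "\<forall>m. S m x \<le> 1"
      using converges_beyond[OF r(1) _ le] by blast
    then have "x \<in> X" using r by (auto simp: X_def)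
    then show False using cSup_upper[OF _ bdd] \<open>r < x\<close> by (fastforce simp: r_def)
  qed
  then obtain N where N: "S N r + r ^ l > 1" by blast
  have "isCont (\<lambda>x. S N x + x ^ l) r" unfolding S_def by (intro continuous_intros)
  then have "(\<lambda>x. S N x + x ^ l) \<midarrow>r\<rightarrow> S N r + r ^ l" by (simp add: isCont_def)
  then have "eventually (\<lambda>x. 1 < S N x + x ^ l) (at_left r)"
    using N order_tendstoD(1) filterlim_at_split by blast
  then obtain b where b: "b < r" "\<And>y. b < y \<Longrightarrow> y < r \<Longrightarrow> 1 < S N y + y ^ l"
    unfolding eventually_at_left_field by blast
  define s where "s = (max b 0 + r) / 2"
  have s: "0 < s" "s < r" "b < s" using b r by (auto simp: s_def max_def field_simps)
  \<comment> \<open>Boundedness is known at members of \<open>X\<close> only, not at the supremum,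
    so a member above \<open>s\<close> takes its place.\<close>
  obtain r' where r': "r' \<in> X" "s < r'"
    using less_cSupE[of s X] s X16 by (auto simp: r_def)
  then obtain B where B: "\<And>m. S m r' \<le> B" by (auto simp: X_def)
  have "real (a n) * r' ^ n \<le> B" for n
  proof -
    have "real (a n) * r' ^ n \<le> S n r'" unfolding S_def
      using r' s by (intro member_le_sum[where f = "\<lambda>n. real (a n) * r' ^ n"]) auto
    then show ?thesis using B[of n] by simp
  qed
  then show ?thesis using s r' b by (meson less_imp_le)
qed

section \<open>Exponential growth from the renewal inequality\<close>

text \<open>The renewal coefficients have weighted sum at least 1 at \<open>s\<close>, so
  \<open>d n * s ^ n\<close> stays above a positive constant, whereas \<open>a n * r ^ n\<close> is
  bounded for some \<open>r > s\<close>. The quotient decays like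
  \<open>(s / r) ^ n\<close>.\<close>

lemma ratio_tendsto_0:
  fixes d :: "nat \<Rightarrow> nat"
  assumes d_l: "d l > 0"
    and renewal: "\<And>n. (\<Sum>j\<in>{1..n}. (a j + (if j = l then 1 else 0)) * d (n - j)) \<le> d n"
  shows "(\<lambda>n. real (a n) / real (a n + d n)) \<longlonglongrightarrow> 0"
proof -
  define c where "c = (\<lambda>j. a j + (if j = l then 1 else 0))"
  obtain s r N B where s: "0 < s" "s < r" and B: "\<And>n. real (a n) * r ^ n \<le> B"
    and N: "1 \<le> S N s + s ^ l"
    using growth_gap by blast
  \<comment> \<open>Either \<open>l = 1\<close> and the extra summand contributes, or
    \<open>a 1 = f 0 = 1\<close>. Hence \<open>d\<close> does not decrease from one index to the
    next, and is positive from \<open>l\<close> on.\<close>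
  have "c 1 \<ge> 1" using f_0 by (auto simp: c_def a_eq)
  have d_pos: "d n \<ge> 1" if "n \<ge> l" for n
    using that
  proof (induction n rule: dec_induct)
    case (step n)
    have "1 * d n \<le> c 1 * d (Suc n - 1)" using \<open>c 1 \<ge> 1\<close> by (intro mult_mono) auto
    also have "\<dots> \<le> (\<Sum>j\<in>{1..Suc n}. c j * d (Suc n - j))"
      by (rule member_le_sum[where f = "\<lambda>j. c j * d (Suc n - j)"]) auto
    also have "\<dots> \<le> d (Suc n)" using renewal[of "Suc n"] by (simp add: c_def)
    finally show ?case using step by simp
  qed (use d_l in simp)
  \<comment> \<open>Long enough to include both the truncation at \<open>N\<close> and the extra
    summand at \<open>l\<close>.\<close>
  define M where "M = max N l"
  have cM: "1 \<le> (\<Sum>j=1..M. real (c j) * s ^ j)"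
  proof -
    have "S N s \<le> (\<Sum>j=1..M. real (a j) * s ^ j)"
    proof -
      have "S N s = (\<Sum>j=1..N. real (a j) * s ^ j)"
        unfolding S_def by (intro sum.mono_neutral_right) (auto simp: a_0 not_less_eq_eq)
      also have "\<dots> \<le> (\<Sum>j=1..M. real (a j) * s ^ j)"
        using s by (intro sum_mono2) (auto simp: M_def)
      finally show ?thesis .
    qed
    moreover have "s ^ l = (\<Sum>j=1..M. (if j = l then s ^ j else 0))"
      using l_pos by (auto simp: M_def)
    ultimately have "1 \<le> (\<Sum>j=1..M. real (a j) * s ^ j + (if j = l then s ^ j else 0))"
      using N by (simp add: sum.distrib)
    also have "\<dots> = (\<Sum>j=1..M. real (c j) * s ^ j)"
      by (intro sum.cong) (auto simp: c_def algebra_simps)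
    finally show ?thesis .
  qed
  \<comment> \<open>The starting window: for \<open>n\<close> beyond it, all \<open>n - j\<close>
    with \<open>j \<le> M\<close> are still at least \<open>l\<close>, so the induction hypothesis
    applies to them.\<close>
  define \<mu> where "\<mu> = Min ((\<lambda>n. real (d n) * s ^ n) ` {l..l+M})"
  have mu: "0 < \<mu>" unfolding \<mu>_def using d_pos s by (subst Min_gr_iff) (force simp: Suc_le_eq)+
  have lower: "\<mu> \<le> real (d n) * s ^ n" if "n \<ge> l" for n
    using that
  proof (induction n rule: less_induct)
    case (less n)
    show ?case
    proof (cases "n \<le> l + M")
      case True
      then show ?thesis unfolding \<mu>_def using less.prems by (intro Min_le) auto
    next
      case False
      have "\<mu> = 1 * \<mu>" by simp
      also have "\<dots> \<le> (\<Sum>j=1..M. real (c j) * s ^ j) * \<mu>"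
        using cM mu by (intro mult_right_mono) auto
      also have "\<dots> \<le> (\<Sum>j=1..M. real (c j) * s ^ j * (real (d (n - j)) * s ^ (n - j)))"
        unfolding sum_distrib_right using False s by (intro sum_mono mult_left_mono less.IH) auto
      also have "\<dots> = (\<Sum>j=1..M. real (c j) * real (d (n - j)) * s ^ n)"
        using False by (intro sum.cong) (auto simp flip: power_add)
      also have "\<dots> \<le> (\<Sum>j=1..n. real (c j) * real (d (n - j)) * s ^ n)"
        using False s by (intro sum_mono2) auto
      also have "\<dots> = real (\<Sum>j=1..n. c j * d (n - j)) * s ^ n"
        by (simp add: sum_distrib_right)
      also have "\<dots> \<le> real (d n) * s ^ n"
        using renewal[of n] s unfolding c_def
        by (intro mult_right_mono of_nat_mono) auto
      finally show ?thesis .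
    qed
  qed
  have le: "real (a n) / real (a n + d n) \<le> B / \<mu> * (s / r) ^ n" if "n \<ge> l" for n
  proof -
    have "real (a n) / real (a n + d n) \<le> real (a n) / real (d n)"
      using d_pos[OF that] by (intro divide_left_mono) auto
    also have "\<dots> = (real (a n) * r ^ n) / (real (d n) * s ^ n) * (s / r) ^ n"
      using s d_pos[OF that] by (simp add: field_simps)
    also have "\<dots> \<le> B / \<mu> * (s / r) ^ n"
      using B[of n] lower[OF that] mu s by (intro mult_right_mono frac_le) (use B[of n] s in \<open>auto intro: order_trans[rotated]\<close>)
    finally show ?thesis .
  qed
  have "(\<lambda>n. (s / r) ^ n) \<longlonglongrightarrow> 0" using s by (intro LIMSEQ_realpow_zero) auto
  then have "(\<lambda>n. B / \<mu> * (s / r) ^ n) \<longlonglongrightarrow> 0" by (rule tendsto_mult_right_zero)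
  then show ?thesis
  proof (rule tendsto_sandwich[OF _ _ tendsto_const, rotated 2])
    show "eventually (\<lambda>n. real (a n) / real (a n + d n) \<le> B / \<mu> * (s / r) ^ n) sequentially"
      using le by (rule eventually_sequentiallyI)
  qed simp
qed

end

section \<open>Generating functions of multisets\<close>

lemma finite_bounded_multisets:
  assumes "finite A"
  shows "finite {M. set_mset M \<subseteq> A \<and> size M \<le> n}"
proof -
  have "{M. set_mset M \<subseteq> A \<and> size M \<le> n} = (\<Union>i\<le>n. multisets_of_size A i)"
    by (auto simp: multisets_of_size_def)
  then show ?thesis using assms by auto
qed

text \<open>A multiset over \<open>insert s A\<close> is a multiplicity of \<open>s\<close> together
  with a multiset over \<open>A\<close>; summing over the multiplicity is a geometric series and
  yields one more factor.\<close>

lemma has_sum_multisets: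
  fixes W :: "'a \<Rightarrow> nat" and x :: real
  assumes "finite A" "\<And>t. t \<in> A \<Longrightarrow> W t > 0" and x: "0 < x" "x < 1"
  shows "((\<lambda>M. x ^ (\<Sum>t\<in>#M. W t)) has_sum (\<Prod>t\<in>A. 1 / (1 - x ^ W t))) {M. set_mset M \<subseteq> A}"
  using assms(1,2)
proof (induction A rule: finite_induct)
  case empty
  have "{M :: 'a multiset. set_mset M \<subseteq> {}} = {{#}}" by auto
  then show ?case by (simp add: has_sum_finite_iff)
next
  case (insert s A)
  let ?P = "\<Prod>t\<in>A. 1 / (1 - x ^ W t)"
  let ?h = "\<lambda>(i, M). replicate_mset i s + M"
  let ?B = "{M. set_mset M \<subseteq> A}"
  let ?f = "\<lambda>(i, M). x ^ (W s * i) * x ^ (\<Sum>t\<in>#M. W t)"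
  have xs: "x ^ W s < 1" using x insert.prems[of s] by (simp add: power_less_one_iff)
  have IH: "((\<lambda>M. x ^ (\<Sum>t\<in>#M. W t)) has_sum ?P) ?B" using insert by simp
  have inner: "((\<lambda>M. ?f (i, M)) has_sum (x ^ (W s * i) * ?P)) ?B" for i
    using has_sum_cmult_right[OF IH, of "x ^ (W s * i)"] by simp
  have "(\<lambda>i. (x ^ W s) ^ i) sums (1 / (1 - x ^ W s))"
    using xs x by (intro geometric_sums) auto
  then have "((\<lambda>i. x ^ (W s * i)) has_sum (1 / (1 - x ^ W s))) UNIV"
    using x by (intro sums_nonneg_imp_has_sum) (auto simp: power_mult)
  then have outer: "((\<lambda>i. x ^ (W s * i) * ?P) has_sum (1 / (1 - x ^ W s) * ?P)) UNIV"
    by (rule has_sum_cmult_left)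
  have "?f summable_on (SIGMA i:UNIV. ?B)"
    using inner by (rule summable_on_SigmaI) (use outer x in \<open>auto simp: summable_on_def\<close>)
  with inner outer have "(?f has_sum (1 / (1 - x ^ W s) * ?P)) (SIGMA i:UNIV. ?B)"
    by (rule has_sum_SigmaI)
  also have "?f = (\<lambda>p. x ^ (\<Sum>t\<in>#?h p. W t))"
    by (auto simp: power_add sum_mset_replicate_mset mult.commute)
  finally have "((\<lambda>p. x ^ (\<Sum>t\<in>#?h p. W t)) has_sum (1 / (1 - x ^ W s) * ?P)) (SIGMA i:UNIV. ?B)" .
  moreover have "bij_betw ?h (SIGMA i:UNIV. ?B) {M. set_mset M \<subseteq> insert s A}"
  proof (rule bij_betwI[where g = "\<lambda>M. (count M s, filter_mset (\<lambda>t. t \<noteq> s) M)"])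
    show "(count (?h p) s, filter_mset (\<lambda>t. t \<noteq> s) (?h p)) = p" if "p \<in> (SIGMA i:UNIV. ?B)" for p
    proof -
      obtain i M where p: "p = (i, M)" by force
      have "s \<notin># M" using that insert.hyps p by auto
      then have "filter_mset (\<lambda>t. t \<noteq> s) M = filter_mset (\<lambda>_. True) M"
        by (intro filter_mset_cong) auto
      then show ?thesis using \<open>s \<notin># M\<close> by (simp add: p count_eq_zero_iff)
    qed
    show "?h (count M s, filter_mset (\<lambda>t. t \<noteq> s) M) = M" for M
      by (simp add: multiset_eq_iff)
  qed (auto split: if_splits)
  ultimately have "((\<lambda>M. x ^ (\<Sum>t\<in>#M. W t)) has_sum (1 / (1 - x ^ W s) * ?P)) {M. set_mset M \<subseteq> insert s A}"
    using has_sum_reindex_bij_betw by blast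
  then show ?case using insert.hyps by simp
qed

section \<open>Isomorphism types of trees\<close>

text \<open>Children form a multiset, so that isomorphic trees become equal and counting up to
  isomorphism becomes counting elements.\<close>

datatype wtree = Node (root_weight: nat) (subtrees: "wtree multiset")

text \<open>The recursive calls pass through \<open>image_mset\<close>, the map function of the
  nesting type; \<open>wsize_Node\<close> and its companions give the forms used later.\<close>

primrec wsize :: "wtree \<Rightarrow> nat" where
  "wsize (Node k M) = k + (\<Sum>i\<in>#image_mset wsize M. i)"

primrec pos_weights :: "wtree \<Rightarrow> bool" where
  "pos_weights (Node k M) \<longleftrightarrow> 0 < k \<and> (\<forall>b\<in>#image_mset pos_weights M. b)"

definition limb_at_root :: "wtree \<Rightarrow> wtree \<Rightarrow> bool" where
  "limb_at_root L T \<longleftrightarrow> root_weight T = root_weight L \<and> subtrees L \<subseteq># subtrees T"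

primrec has_wlimb :: "wtree \<Rightarrow> wtree \<Rightarrow> bool" where
  "has_wlimb L (Node k M) \<longleftrightarrow> limb_at_root L (Node k M) \<or> (\<exists>b\<in>#image_mset (has_wlimb L) M. b)"

abbreviation fsize :: "wtree multiset \<Rightarrow> nat" where
  "fsize M \<equiv> (\<Sum>T\<in>#M. wsize T)"

lemma wsize_Node [simp]: "wsize (Node k M) = k + fsize M"
  by simp

lemma pos_weights_Node [simp]: "pos_weights (Node k M) \<longleftrightarrow> 0 < k \<and> (\<forall>T\<in>#M. pos_weights T)"
  by simp

lemma has_wlimb_iff: "has_wlimb L T \<longleftrightarrow> limb_at_root L T \<or> (\<exists>S\<in>#subtrees T. has_wlimb L S)"
  by (cases T) simp

declare wsize.simps [simp del] pos_weights.simps [simp del] has_wlimb.simps [simp del]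

lemma has_wlimb_self: "has_wlimb L L"
  by (simp add: has_wlimb_iff[of L L] limb_at_root_def)

lemma wsize_pos: "pos_weights T \<Longrightarrow> 0 < wsize T"
  by (cases T) simp

lemma fsize_mono: "M \<subseteq># N \<Longrightarrow> fsize M \<le> fsize N"
  by (auto simp: subset_mset.le_iff_add)

lemma wsize_le_fsize: "T \<in># M \<Longrightarrow> wsize T \<le> fsize M"
  by (auto dest: multi_member_split)

lemma wsize_subtree: "pos_weights T \<Longrightarrow> S \<in># subtrees T \<Longrightarrow> wsize S < wsize T"
  by (cases T) (auto dest: wsize_le_fsize)

lemma size_le_fsize: "\<forall>T\<in>#M. pos_weights T \<Longrightarrow> size M \<le> fsize M"
  by (induction M) (auto dest: wsize_pos)

lemma wsize_le_of_has_wlimb: "has_wlimb L T \<Longrightarrow> wsize L \<le> wsize T"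
proof (induction T)
  case (Node k M)
  show ?case
  proof (cases "limb_at_root L (Node k M)")
    case True
    then show ?thesis by (cases L) (auto simp: limb_at_root_def dest: fsize_mono)
  next
    case False
    then obtain S where "S \<in># M" "has_wlimb L S" using Node.prems by (auto simp: has_wlimb_iff[of L "Node k M"])
    then show ?thesis using Node.IH[of S] wsize_le_fsize[of S M] by simp
  qed
qed

text \<open>A tree having \<open>L\<close> weighs at least as much as \<open>L\<close>, but a proper
  subtree of \<open>L\<close> weighs less.\<close>

lemma subtrees_avoid: "pos_weights L \<Longrightarrow> S \<in># subtrees L \<Longrightarrow> \<not> has_wlimb L S"
  using wsize_subtree wsize_le_of_has_wlimb by fastforce

text \<open>Subtrees weigh strictly less than the tree, and positive weights bound their number, so
  only finitely many root weights and multisets of smaller trees occur.\<close>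

lemma finite_trees_le: "finite {T. pos_weights T \<and> wsize T \<le> n}"
proof (induction n)
  case 0
  have "{T. pos_weights T \<and> wsize T \<le> 0} = {}" by (auto dest: wsize_pos)
  then show ?case by (simp only: finite.emptyI)
next
  case (Suc n)
  let ?A = "{T. pos_weights T \<and> wsize T \<le> n}"
  have "T \<in> (\<lambda>(k, M). Node k M) ` ({..Suc n} \<times> {M. set_mset M \<subseteq> ?A \<and> size M \<le> Suc n})"
    if T: "pos_weights T" "wsize T \<le> Suc n" for T
  proof (cases T)
    case (Node k M)
    have "S \<in> ?A" if "S \<in># M" for S
      using wsize_subtree[of T S] that T Node by simp
    moreover have "size M \<le> Suc n" using size_le_fsize[of M] T Node by simp
    ultimately show ?thesis using T Node by (intro image_eqI[of _ _ "(k, M)"]) auto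
  qed
  then have "{T. pos_weights T \<and> wsize T \<le> Suc n} \<subseteq>
      (\<lambda>(k, M). Node k M) ` ({..Suc n} \<times> {M. set_mset M \<subseteq> ?A \<and> size M \<le> Suc n})"
    by blast
  then show ?case
    by (rule finite_subset) (intro finite_imageI finite_cartesian_product finite_bounded_multisets Suc finite_atMost)
qed

lemma finite_trees: "finite {T. pos_weights T \<and> P T \<and> wsize T = n}"
  by (rule finite_subset[OF _ finite_trees_le[of n]]) auto

lemma finite_forests_le: "finite {M. (\<forall>T\<in>#M. pos_weights T) \<and> fsize M \<le> n}"
proof (rule finite_subset)
  show "{M. (\<forall>T\<in>#M. pos_weights T) \<and> fsize M \<le> n} \<subseteq>
      {M. set_mset M \<subseteq> {T. pos_weights T \<and> wsize T \<le> n} \<and> size M \<le> n}"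
    by (auto dest: size_le_fsize wsize_le_fsize)
  show "finite {M. set_mset M \<subseteq> {T. pos_weights T \<and> wsize T \<le> n} \<and> size M \<le> n}"
    by (intro finite_bounded_multisets finite_trees_le)
qed

section \<open>Counting trees that avoid or have the limb\<close>

locale positive_limb =
  fixes L :: wtree
  assumes pos_weights_L: "pos_weights L"
begin

definition avoiders :: "wtree set" where "avoiders = {T. pos_weights T \<and> \<not> has_wlimb L T}"
definition avoiding_forests :: "wtree multiset set" where "avoiding_forests = {M. set_mset M \<subseteq> avoiders}"
definition num_avoiders :: "nat \<Rightarrow> nat" where "num_avoiders n = card {T \<in> avoiders. wsize T = n}"
definition num_forests :: "nat \<Rightarrow> nat" where "num_forests n = card {M \<in> avoiding_forests. fsize M = n}"
definition num_having :: "nat \<Rightarrow> nat" where "num_having n = card {T. pos_weights T \<and> has_wlimb L T \<and> wsize T = n}"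

lemma finite_avoiders_le: "finite {T \<in> avoiders. wsize T \<le> n}"
  by (rule finite_subset[OF _ finite_trees_le[of n]]) (auto simp: avoiders_def)

lemma finite_avoiders: "finite {T \<in> avoiders. wsize T = n}"
  by (rule finite_subset[OF _ finite_avoiders_le[of n]]) auto

lemma finite_avoiding_forests_le: "finite {M \<in> avoiding_forests. fsize M \<le> n}"
  by (rule finite_subset[OF _ finite_forests_le[of n]]) (auto simp: avoiding_forests_def avoiders_def)

lemma finite_avoiding_forests: "finite {M \<in> avoiding_forests. fsize M = n}"
  by (rule finite_subset[OF _ finite_avoiding_forests_le[of n]]) auto

lemma num_forests_0: "num_forests 0 = 1"
proof -
  have "{M \<in> avoiding_forests. fsize M = 0} = {{#}}"
  proof (intro equalityI subsetI)
    fix M assume "M \<in> {M \<in> avoiding_forests. fsize M = 0}"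
    then have "\<forall>T\<in>#M. pos_weights T" "fsize M = 0" unfolding avoiding_forests_def avoiders_def by blast+
    then have "size M \<le> 0" using size_le_fsize[of M] by (simp only:)
    then show "M \<in> {{#}}" by simp
  qed (simp add: avoiding_forests_def)
  then show ?thesis by (simp add: num_forests_def)
qed

text \<open>A root weight and an avoiding forest form an avoider unless \<open>L\<close> is a limb
  at the root. Those bad pairs all have the root weight of \<open>L\<close>, and removing the
  subtrees of \<open>L\<close>, which themselves avoid \<open>L\<close>, matches them with the
  avoiding forests of weight \<open>n - wsize L\<close>. Their number thus cancels the summand
  \<open>k = wsize L\<close>.\<close>

lemma num_avoiders_eq: "num_avoiders n = (\<Sum>k\<in>{1..n} - {wsize L}. num_forests (n - k))"
proof -
  define U where "U = (SIGMA k:{1..n}. {M \<in> avoiding_forests. fsize M = n - k})"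
  define Bad where "Bad = {p \<in> U. limb_at_root L (Node (fst p) (snd p))}"
  have finU: "finite U" unfolding U_def by (intro finite_SigmaI finite_avoiding_forests finite_atLeastAtMost)
  have "bij_betw (\<lambda>(k, M). Node k M) (U - Bad) {T \<in> avoiders. wsize T = n}"
  proof (rule bij_betwI[where g = "\<lambda>T. (root_weight T, subtrees T)"])
    show "(\<lambda>(k, M). Node k M) \<in> U - Bad \<rightarrow> {T \<in> avoiders. wsize T = n}"
      by (auto simp: U_def Bad_def avoiding_forests_def avoiders_def has_wlimb_iff[of L "Node _ _"])
    show "(\<lambda>T. (root_weight T, subtrees T)) \<in> {T \<in> avoiders. wsize T = n} \<rightarrow> U - Bad"
    proof
      fix T assume "T \<in> {T \<in> avoiders. wsize T = n}"
      then show "(root_weight T, subtrees T) \<in> U - Bad"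
        by (cases T) (auto simp: U_def Bad_def avoiding_forests_def avoiders_def has_wlimb_iff[of L "Node _ _"])
    qed
  qed auto
  then have "num_avoiders n = card (U - Bad)" unfolding num_avoiders_def by (simp add: bij_betw_same_card)
  also have "\<dots> = card U - card Bad"
    using finU by (intro card_Diff_subset) (auto simp: Bad_def intro: finite_subset)
  finally have "num_avoiders n = card U - card Bad" .
  moreover have "card U = (\<Sum>k\<in>{1..n}. num_forests (n - k))"
    unfolding U_def num_forests_def by (subst card_SigmaI) (auto intro: finite_avoiding_forests)
  moreover have "card Bad = (if wsize L \<le> n then num_forests (n - wsize L) else 0)"
  proof -
    obtain kL KL where L: "L = Node kL KL" by (cases L)
    have wL: "wsize L = kL + fsize KL" by (simp add: L)
    have limb_at_root_iff: "limb_at_root L (Node k M) \<longleftrightarrow> k = kL \<and> KL \<subseteq># M" for k M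
      by (simp add: limb_at_root_def L)
    have kL: "0 < kL" using pos_weights_L L by simp
    have KL_avoid: "set_mset KL \<subseteq> avoiders"
      using pos_weights_L subtrees_avoid[OF pos_weights_L] unfolding avoiders_def by (auto simp: L)
    have "Bad = (\<lambda>M. (kL, KL + M)) ` {M \<in> avoiding_forests. wsize L + fsize M = n}"
    proof (intro equalityI subsetI)
      fix p assume "p \<in> Bad"
      then obtain N where p: "p = (kL, N)" "KL \<subseteq># N" "N \<in> avoiding_forests" "kL + fsize N = n"
        by (auto simp: Bad_def U_def limb_at_root_iff)
      then obtain M where "N = KL + M" by (auto simp: subset_mset.le_iff_add)
      with p show "p \<in> (\<lambda>M. (kL, KL + M)) ` {M \<in> avoiding_forests. wsize L + fsize M = n}"
        by (auto simp: avoiding_forests_def wL)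
    next
      fix p assume "p \<in> (\<lambda>M. (kL, KL + M)) ` {M \<in> avoiding_forests. wsize L + fsize M = n}"
      then show "p \<in> Bad"
        using KL_avoid kL wL limb_at_root_iff by (auto simp: Bad_def U_def avoiding_forests_def)
    qed
    then have "card Bad = card {M \<in> avoiding_forests. wsize L + fsize M = n}"
      by (simp add: card_image inj_on_def)
    also have "{M \<in> avoiding_forests. wsize L + fsize M = n} =
        (if wsize L \<le> n then {M \<in> avoiding_forests. fsize M = n - wsize L} else {})"
      by auto
    finally show ?thesis by (simp add: num_forests_def)
  qed
  ultimately have "num_avoiders n = (\<Sum>k\<in>{1..n}. num_forests (n - k)) - (if wsize L \<le> n then num_forests (n - wsize L) else 0)"
    by simp
  also have "\<dots> = (\<Sum>k\<in>{1..n} - {wsize L}. num_forests (n - k))"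
    using wsize_pos[OF pos_weights_L] by (simp add: sum_diff1_nat)
  finally show ?thesis .
qed

text \<open>Grafting a tree \<open>R\<close> having \<open>L\<close> onto the root of
  \<open>S\<close>, where \<open>S\<close> avoids \<open>L\<close> or is \<open>L\<close> itself, is
  injective: no other branch of the result has \<open>L\<close>. The case \<open>S = L\<close>
  accounts for the extra 1.\<close>

lemma renewal:
  "(\<Sum>j\<in>{1..n}. (num_avoiders j + (if j = wsize L then 1 else 0)) * num_having (n - j)) \<le> num_having n"
proof -
  define C where "C = (\<lambda>j. {S. (S \<in> avoiders \<or> S = L) \<and> wsize S = j})"
  define D where "D = (\<lambda>m. {T. pos_weights T \<and> has_wlimb L T \<and> wsize T = m})"
  define U where "U = (SIGMA j:{1..n}. C j \<times> D (n - j))"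
  define h where "h = (\<lambda>(j :: nat, S, R). Node (root_weight S) (add_mset R (subtrees S)))"
  have C_eq: "C j = {T \<in> avoiders. wsize T = j} \<union> (if j = wsize L then {L} else {})" for j
    by (auto simp: C_def)
  have finC: "finite (C j)" for j unfolding C_eq using finite_avoiders by simp
  have finD: "finite (D m)" for m unfolding D_def by (rule finite_trees)
  have "L \<notin> avoiders" by (simp add: avoiders_def has_wlimb_self)
  then have cardC: "card (C j) = num_avoiders j + (if j = wsize L then 1 else 0)" for j
    unfolding C_eq num_avoiders_def using finite_avoiders by (auto simp: card_insert_if)
  have posC: "pos_weights S" if "S \<in> C j" for S j
    using that pos_weights_L by (auto simp: C_def avoiders_def)
  have subC: "\<not> has_wlimb L Q" if "S \<in> C j" "Q \<in># subtrees S" for S Q j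
    using that subtrees_avoid[OF pos_weights_L] has_wlimb_iff[of L S] by (auto simp: C_def avoiders_def)
  have "inj_on h U"
  proof (rule inj_onI)
    fix p p' assume p: "p \<in> U" "p' \<in> U" "h p = h p'"
    obtain j S R j' S' R' where eq: "p = (j, S, R)" "p' = (j', S', R')" by (metis prod_cases3)
    have S: "S \<in> C j" "R \<in> D (n - j)" "S' \<in> C j'" "R' \<in> D (n - j')"
      using p by (auto simp: U_def eq)
    have e: "root_weight S = root_weight S'"
      "add_mset R (subtrees S) = add_mset R' (subtrees S')"
      using p by (auto simp: h_def eq)
    have "R \<in># add_mset R' (subtrees S')" by (simp flip: e(2))
    \<comment> \<open>Otherwise \<open>R\<close> would be a subtree of \<open>S'\<close>, and none
      of these has \<open>L\<close>.\<close>
    then have "R = R'" using subC[OF S(3)] S(2) by (auto simp: D_def)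
    with e have "S = S'" by (simp add: wtree.expand)
    moreover have "j = j'" using S \<open>S = S'\<close> by (simp add: C_def)
    ultimately show "p = p'" using \<open>R = R'\<close> eq by simp
  qed
  moreover have "h ` U \<subseteq> D n"
  proof
    fix T assume "T \<in> h ` U"
    then obtain j S R where T: "T = Node (root_weight S) (add_mset R (subtrees S))"
      and S: "j \<in> {1..n}" "S \<in> C j" "R \<in> D (n - j)"
      by (auto simp: U_def h_def)
    have "has_wlimb L T" using S unfolding T by (subst has_wlimb_iff) (simp add: D_def)
    moreover have "pos_weights T" using posC[OF S(2)] S(3) by (cases S) (auto simp: T D_def)
    moreover have "wsize T = n" using S by (cases S) (auto simp: T D_def C_def)
    ultimately show "T \<in> D n" by (simp add: D_def)
  qed
  ultimately have "card U \<le> card (D n)" using finD by (intro card_inj_on_le)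
  moreover have "card U = (\<Sum>j\<in>{1..n}. card (C j) * card (D (n - j)))"
    unfolding U_def using finC finD by (subst card_SigmaI) (auto simp: card_cartesian_product)
  moreover have "card (D m) = num_having m" for m by (simp add: D_def num_having_def)
  ultimately show ?thesis by (simp only: cardC)
qed

lemma sum_num_forests: "(\<Sum>i\<le>m. real (num_forests i) * x ^ i) = (\<Sum>M | M \<in> avoiding_forests \<and> fsize M \<le> m. x ^ fsize M)"
proof -
  have "(\<Sum>M | M \<in> avoiding_forests \<and> fsize M \<le> m. x ^ fsize M) =
      (\<Sum>i\<le>m. \<Sum>M | M \<in> {M \<in> avoiding_forests. fsize M \<le> m} \<and> fsize M = i. x ^ fsize M)"
    by (rule sum.group[symmetric]) (use finite_avoiding_forests_le in auto)
  also have "\<dots> = (\<Sum>i\<le>m. real (num_forests i) * x ^ i)"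
    by (intro sum.cong refl) (auto simp: num_forests_def intro!: arg_cong[where f = card])
  finally show ?thesis ..
qed

text \<open>Restricting to trees of weight at most \<open>m\<close> leaves a finite product;
  grouping its factors by weight and taking logarithms gives the exponent.\<close>

lemma euler_product:
  assumes x: "0 < x" "x < 1"
  shows "((\<lambda>M. x ^ fsize M) has_sum exp (\<Sum>j\<le>m. real (num_avoiders j) * - ln (1 - x ^ j)))
    {M. set_mset M \<subseteq> {T \<in> avoiders. wsize T \<le> m}}"
proof -
  let ?A = "{T \<in> avoiders. wsize T \<le> m}"
  have pos: "0 < wsize T" if "T \<in> ?A" for T
    using that wsize_pos by (auto simp: avoiders_def)
  have "(\<Sum>T\<in>?A. - ln (1 - x ^ wsize T)) =
      (\<Sum>j\<le>m. \<Sum>T | T \<in> ?A \<and> wsize T = j. - ln (1 - x ^ wsize T))"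
    by (rule sum.group[symmetric]) (use finite_avoiders_le in auto)
  also have "\<dots> = (\<Sum>j\<le>m. real (num_avoiders j) * - ln (1 - x ^ j))"
    by (intro sum.cong refl) (auto simp: num_avoiders_def intro!: arg_cong[where f = card])
  finally have "exp (\<Sum>j\<le>m. real (num_avoiders j) * - ln (1 - x ^ j)) = (\<Prod>T\<in>?A. exp (- ln (1 - x ^ wsize T)))"
    by (simp only: exp_sum[OF finite_avoiders_le, symmetric])
  also have "\<dots> = (\<Prod>T\<in>?A. 1 / (1 - x ^ wsize T))"
  proof (intro prod.cong refl)
    fix T assume "T \<in> ?A"
    then have "x ^ wsize T < 1" using x pos[of T] by (simp add: power_less_one_iff)
    then show "exp (- ln (1 - x ^ wsize T)) = 1 / (1 - x ^ wsize T)"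
      by (simp add: exp_minus inverse_eq_divide)
  qed
  finally show ?thesis using has_sum_multisets[OF finite_avoiders_le[of m] pos x] by simp
qed

sublocale limb_free_gf num_avoiders num_forests "wsize L"
proof
  show "0 < wsize L" using pos_weights_L by (rule wsize_pos)
  show "num_avoiders n = (\<Sum>k\<in>{1..n} - {wsize L}. num_forests (n - k))" for n by (rule num_avoiders_eq)
  show "num_forests 0 = 1" by (rule num_forests_0)
  fix x :: real and m assume x: "0 < x" "x < 1"
  let ?B = "{M. set_mset M \<subseteq> {T \<in> avoiders. wsize T \<le> m}}"
  have "((\<lambda>M. x ^ fsize M) has_sum (\<Sum>M | M \<in> avoiding_forests \<and> fsize M \<le> m. x ^ fsize M)) {M. M \<in> avoiding_forests \<and> fsize M \<le> m}"
    using finite_avoiding_forests_le by (intro has_sum_finite) auto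
  \<comment> \<open>A forest of weight at most \<open>m\<close> contains only trees of weight at
    most \<open>m\<close>, so the truncated sum uses only some terms of the expanded
    product.\<close>
  moreover have "{M. M \<in> avoiding_forests \<and> fsize M \<le> m} \<subseteq> ?B"
    unfolding avoiding_forests_def by (auto intro: order_trans[OF wsize_le_fsize])
  ultimately show "(\<Sum>i\<le>m. real (num_forests i) * x ^ i) \<le> exp (\<Sum>j\<le>m. real (num_avoiders j) * - ln (1 - x ^ j))"
    unfolding sum_num_forests using has_sum_mono2[OF _ euler_product[OF x, of m]] x by auto
  assume sm: "summable (\<lambda>i. real (num_forests i) * x ^ i)"
  show "exp (\<Sum>j\<le>m. real (num_avoiders j) * - ln (1 - x ^ j)) \<le> (\<Sum>i. real (num_forests i) * x ^ i)"
    using euler_product[OF x]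
  proof (rule has_sum_le_finite_sums)
    fix F assume F: "finite F" "F \<subseteq> ?B"
    \<comment> \<open>Every finite set of forests has bounded weight and so lies inside one partial
      sum of the series. The \<open>0\<close> keeps \<open>Max\<close> meaningful for empty
      \<open>F\<close>.\<close>
    define n where "n = Max (insert 0 (fsize ` F))"
    have "F \<subseteq> {M \<in> avoiding_forests. fsize M \<le> n}"
      using F by (auto simp: n_def avoiding_forests_def)
    then have "(\<Sum>M\<in>F. x ^ fsize M) \<le> (\<Sum>M | M \<in> avoiding_forests \<and> fsize M \<le> n. x ^ fsize M)"
      using finite_avoiding_forests_le x by (intro sum_mono2) auto
    also have "\<dots> \<le> (\<Sum>i. real (num_forests i) * x ^ i)"
      unfolding sum_num_forests[symmetric] using x by (intro sum_le_suminf sm) auto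
    finally show "(\<Sum>M\<in>F. x ^ fsize M) \<le> (\<Sum>i. real (num_forests i) * x ^ i)" .
  qed
qed

lemma num_having_pos: "0 < num_having (wsize L)"
  unfolding num_having_def using pos_weights_L has_wlimb_self finite_trees by (subst card_gt_0_iff) blast

lemma wtree_limb_proportion:
  "(\<lambda>n. real (card {T. pos_weights T \<and> has_wlimb L T \<and> wsize T = n}) /
     real (card {T. pos_weights T \<and> wsize T = n})) \<longlonglongrightarrow> 1"
proof -
  have split: "card {T. pos_weights T \<and> wsize T = n} = num_avoiders n + num_having n" for n
  proof -
    have "{T. pos_weights T \<and> wsize T = n} =
        {T \<in> avoiders. wsize T = n} \<union> {T. pos_weights T \<and> has_wlimb L T \<and> wsize T = n}"
      by (auto simp: avoiders_def)
    also have "card \<dots> = num_avoiders n + num_having n" unfolding num_avoiders_def num_having_def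
      by (rule card_Un_disjoint) (use finite_avoiders finite_trees in \<open>auto simp: avoiders_def\<close>)
    finally show ?thesis .
  qed
  have "num_avoiders n + num_having n > 0" if "n \<ge> 1" for n
  proof -
    have "Node n {#} \<in> {T. pos_weights T \<and> wsize T = n}" using that by simp
    then show ?thesis using finite_trees[of "\<lambda>_. True" n]
      unfolding split[symmetric] card_gt_0_iff by (metis (no_types, lifting) Collect_cong empty_iff)
  qed
  \<comment> \<open>At \<open>n = 0\<close> there are no trees and division by zero gives 0, so the
    identity fails there.\<close>
  then have "eventually (\<lambda>n. 1 - real (num_avoiders n) / real (num_avoiders n + num_having n) = real (num_having n) / real (num_avoiders n + num_having n)) sequentially"
  proof (intro eventually_sequentiallyI[of 1])
    fix n :: nat
    assume "1 \<le> n" "\<And>n. 1 \<le> n \<Longrightarrow> 0 < num_avoiders n + num_having n"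
    then have "real (num_avoiders n + num_having n) \<noteq> 0" by (metis less_irrefl of_nat_eq_0_iff)
    then show "1 - real (num_avoiders n) / real (num_avoiders n + num_having n) = real (num_having n) / real (num_avoiders n + num_having n)"
      by (simp add: field_simps)
  qed
  moreover have "(\<lambda>n. 1 - real (num_avoiders n) / real (num_avoiders n + num_having n)) \<longlonglongrightarrow> 1 - 0"
    by (intro tendsto_intros ratio_tendsto_0[OF num_having_pos renewal])
  ultimately show ?thesis
    unfolding split num_having_def[symmetric] by (simp add: tendsto_cong)
qed

end

section \<open>Vertex-labelled trees and their isomorphism types\<close>

text \<open>Matches one element at a time. It turns equal multisets of child codes into a
  code-preserving bijection between the children.\<close>

lemma ex_bij_betw_same_image_mset:
  assumes "finite A" "finite B"
    and "image_mset f (mset_set A) = image_mset g (mset_set B)"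
  shows "\<exists>h. bij_betw h A B \<and> (\<forall>x\<in>A. g (h x) = f x)"
  using assms
proof (induction A arbitrary: B rule: finite_induct)
  case empty
  then have "B = {}" by (auto simp: mset_set_empty_iff)
  then show ?case by (auto simp: bij_betw_def)
next
  case (insert x A)
  have "f x \<in># image_mset g (mset_set B)"
    using insert.hyps insert.prems(2)[symmetric] by simp
  then obtain y where y: "y \<in> B" "g y = f x" using insert.prems(1) by auto
  have "image_mset g (mset_set B) = add_mset (g y) (image_mset g (mset_set (B - {y})))"
    using y insert.prems(1) by (simp add: mset_set.remove)
  then have "image_mset f (mset_set A) = image_mset g (mset_set (B - {y}))"
    using insert.hyps insert.prems(2) y by simp
  then obtain h where h: "bij_betw h A (B - {y})" "\<forall>x\<in>A. g (h x) = f x"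
    using insert.IH[of "B - {y}"] insert.prems(1) by auto
  define h' where "h' = h(x := y)"
  have "bij_betw h' A (B - {y})"
    using h(1) insert.hyps by (subst bij_betw_cong[of A h' h]) (auto simp: h'_def)
  then have "bij_betw h' (A \<union> {x}) ((B - {y}) \<union> {y})"
    by (intro bij_betw_combine) (auto simp: h'_def bij_betw_def)
  moreover have "(B - {y}) \<union> {y} = B" "A \<union> {x} = insert x A" using y by auto
  moreover have "\<forall>z\<in>insert x A. g (h' z) = f z" using h(2) y insert.hyps by (auto simp: h'_def)
  ultimately show ?case by metis
qed

text \<open>A sub-multiset of \<open>mset_set A\<close> has multiplicities at most 1 and is
  therefore given by its support. This links limbs as sets of children with limbs as sub-multisets
  of codes.\<close>

lemma subset_image_mset_iff:
  assumes "finite A"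
  shows "M \<subseteq># image_mset f (mset_set A) \<longleftrightarrow> (\<exists>C\<subseteq>A. image_mset f (mset_set C) = M)"
proof
  assume "M \<subseteq># image_mset f (mset_set A)"
  then obtain B C where BC: "mset_set A = B + C" "M = image_mset f B"
    by (metis image_mset_eq_plusD subset_mset.le_iff_add)
  have sub: "B \<subseteq># mset_set A" by (simp add: BC)
  then have "count B x \<le> 1" for x
    by (metis count_mset_set(2,3) le_numeral_extra(3,4) mset_subset_eq_count order_trans assms count_mset_set(1) zero_le_one)
  then have "mset_set (set_mset B) = B"
    by (intro multiset_eqI) (metis One_nat_def count_eq_zero_iff count_mset_set(1,3) finite_set_mset le_antisym less_one linorder_not_less Suc_leI neq0_conv)
  moreover have "set_mset B \<subseteq> A" using sub assms by (metis finite_set_mset_mset_set set_mset_mono)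
  ultimately show "\<exists>C\<subseteq>A. image_mset f (mset_set C) = M" using BC by metis
next
  assume "\<exists>C\<subseteq>A. image_mset f (mset_set C) = M"
  then show "M \<subseteq># image_mset f (mset_set A)"
    using assms by (auto intro!: image_mset_subseteq_mono simp: subset_imp_msubset_mset_set)
qed

section \<open>Descendants and canonical codes of vertices\<close>

locale weighted_tree =
  fixes T :: "'v wrtree"
  assumes wrt: "weighted_rooted_tree T"
begin

lemma finite_verts: "finite (verts T)"
  and root_in: "root T \<in> verts T"
  and edges_sub: "edges T \<subseteq> verts T \<times> verts T"
  and no_parent_root: "(u, root T) \<notin> edges T"
  and ex1_parent: "v \<in> verts T \<Longrightarrow> v \<noteq> root T \<Longrightarrow> \<exists>!u. (u, v) \<in> edges T"
  and reachable: "v \<in> verts T \<Longrightarrow> (root T, v) \<in> (edges T)\<^sup>*"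
  and weight_pos: "v \<in> verts T \<Longrightarrow> 0 < weight T v"
  using wrt unfolding weighted_rooted_tree_def by blast+

lemma parent_unique: "(u, v) \<in> edges T \<Longrightarrow> (u', v) \<in> edges T \<Longrightarrow> u = u'"
  using ex1_parent[of v] no_parent_root edges_sub by blast

text \<open>The root has no parent and so lies on no cycle. A cycle through a vertex passes through
  its unique parent, so freedom from cycles spreads along the path from the root.\<close>

lemma acyclic_edges: "acyclic (edges T)"
proof (rule acyclicI, rule allI, rule notI)
  fix x assume cyc: "(x, x) \<in> (edges T)\<^sup>+"
  then have "x \<in> verts T" using edges_sub trancl_subset_Sigma by blast
  then have "(root T, x) \<in> (edges T)\<^sup>*" by (rule reachable)
  then have "(x, x) \<notin> (edges T)\<^sup>+"
  proof (induction rule: rtrancl_induct)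
    case base
    then show ?case using no_parent_root by (meson tranclD2)
  next
    case (step y z)
    show ?case
    proof
      assume "(z, z) \<in> (edges T)\<^sup>+"
      then obtain p where "(z, p) \<in> (edges T)\<^sup>*" "(p, z) \<in> edges T" by (meson tranclD2)
      then have "(z, y) \<in> (edges T)\<^sup>*" using parent_unique[OF step.hyps(2)] by blast
      then have "(y, y) \<in> (edges T)\<^sup>+" using step.hyps(2) by (rule rtrancl_into_trancl2[rotated])
      then show False using step.IH by simp
    qed
  qed
  then show False using cyc by simp
qed

lemma wf_edges: "wf ((edges T)\<inverse>)"
  by (intro finite_acyclic_wf_converse acyclic_edges finite_subset[OF edges_sub])
    (simp add: finite_verts)

lemma no_loop: "(u, v) \<in> (edges T)\<^sup>* \<Longrightarrow> (v, u) \<notin> edges T"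
  using acyclic_edges by (meson acyclic_def rtrancl_into_trancl1)

lemma children_verts: "children T v \<subseteq> verts T"
  using edges_sub by (auto simp: children_def)

lemma finite_children: "finite (children T v)"
  using children_verts finite_verts by (rule finite_subset)

lemma descendants_verts: "v \<in> verts T \<Longrightarrow> descendants T v \<subseteq> verts T"
proof
  fix w assume "v \<in> verts T" "w \<in> descendants T v"
  then have "(v, w) \<in> (edges T)\<^sup>*" by (simp add: descendants_def)
  then show "w \<in> verts T" using \<open>v \<in> verts T\<close> edges_sub by (induction rule: rtrancl_induct) auto
qed

lemma finite_descendants: "v \<in> verts T \<Longrightarrow> finite (descendants T v)"
  using descendants_verts finite_verts finite_subset by blast

lemma descendants_root: "descendants T (root T) = verts T"
  using descendants_verts[OF root_in] reachable by (auto simp: descendants_def)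

lemma descendants_self: "v \<in> descendants T v"
  by (simp add: descendants_def)

lemma descendants_eq: "descendants T v = insert v (\<Union>c\<in>children T v. descendants T c)"
  by (auto simp: descendants_def children_def elim: converse_rtranclE intro: converse_rtrancl_into_rtrancl)

lemma descendants_child: "c \<in> children T v \<Longrightarrow> w \<in> descendants T c \<Longrightarrow> w \<in> descendants T v"
  by (subst descendants_eq) blast

lemma descendants_cases:
  assumes "w \<in> descendants T v"
  obtains "w = v" | c where "c \<in> children T v" "w \<in> descendants T c"
  using assms by (subst (asm) descendants_eq) blast

lemma descendants_step: "u \<in> descendants T v \<Longrightarrow> (u, w) \<in> edges T \<Longrightarrow> w \<in> descendants T v"
  by (auto simp: descendants_def)

text \<open>Unique parents make the ancestors of \<open>w\<close> a chain, so \<open>c\<close> and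
  \<open>c'\<close> are comparable. If they differed, one would lie below the other, and their
  common parent \<open>v\<close> would be a proper descendant of its own child.\<close>

lemma descendants_disjoint:
  assumes "c \<in> children T v" "c' \<in> children T v" "w \<in> descendants T c" "w \<in> descendants T c'"
  shows "c = c'"
proof (rule ccontr)
  assume ne: "c \<noteq> c'"
  have key: False if d: "(d, d') \<in> (edges T)\<^sup>*" "d \<noteq> d'" "(v, d) \<in> edges T" "(v, d') \<in> edges T" for d d'
  proof -
    obtain p where p: "(d, p) \<in> (edges T)\<^sup>*" "(p, d') \<in> edges T"
      using d(1,2) by (meson rtranclE)
    then show False using parent_unique[OF d(4) p(2)] no_loop[OF p(1)] d(3) by blast
  qed
  have "single_valued ((edges T)\<inverse>)" using parent_unique by (auto simp: single_valued_def)
  moreover have "(w, c) \<in> ((edges T)\<inverse>)\<^sup>*" "(w, c') \<in> ((edges T)\<inverse>)\<^sup>*"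
    using assms by (auto simp: descendants_def rtrancl_converse)
  ultimately have "(c, c') \<in> ((edges T)\<inverse>)\<^sup>* \<or> (c', c) \<in> ((edges T)\<inverse>)\<^sup>*"
    by (rule single_valued_confluent)
  then show False using key[of c c'] key[of c' c] ne assms
    by (auto simp: rtrancl_converse children_def)
qed

lemma self_notin_descendants: "c \<in> children T v \<Longrightarrow> v \<notin> descendants T c"
  using no_loop by (auto simp: children_def descendants_def)

text \<open>The isomorphism type of the full subtree at a vertex, by well-founded recursion from a
  vertex to its children.\<close>

definition code :: "'v \<Rightarrow> wtree" where
  "code = wfrec ((edges T)\<inverse>) (\<lambda>g v. Node (weight T v) (image_mset g (mset_set (children T v))))"

lemma code_eq: "code v = Node (weight T v) (image_mset code (mset_set (children T v)))"
proof -
  have "code v = Node (weight T v) (image_mset (cut code ((edges T)\<inverse>) v) (mset_set (children T v)))"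
    unfolding code_def by (subst wfrec[OF wf_edges]) simp
  also have "image_mset (cut code ((edges T)\<inverse>) v) (mset_set (children T v)) =
      image_mset code (mset_set (children T v))"
  proof (intro image_mset_cong)
    fix c assume "c \<in># mset_set (children T v)"
    then have "c \<in> children T v" by (simp add: finite_children)
    then show "cut code ((edges T)\<inverse>) v c = code c" by (simp add: cut_apply children_def)
  qed
  finally show ?thesis .
qed

lemma vertex_induct [consumes 1, case_names step]:
  assumes "v \<in> verts T"
    and "\<And>v. v \<in> verts T \<Longrightarrow> (\<And>c. c \<in> children T v \<Longrightarrow> P c) \<Longrightarrow> P v"
  shows "P v"
  using wf_edges assms(1)
proof (induction v rule: wf_induct_rule)
  case (less v)
  show ?case
  proof (rule assms(2)[OF less.prems])
    fix c assume "c \<in> children T v"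
    then show "P c" using less.IH[of c] children_verts[of v] by (auto simp: children_def)
  qed
qed

lemma pos_weights_code: "v \<in> verts T \<Longrightarrow> pos_weights (code v)"
proof (induction rule: vertex_induct)
  case (step v)
  then show ?case by (subst code_eq) (auto simp: weight_pos finite_children)
qed

lemma wsize_code: "v \<in> verts T \<Longrightarrow> wsize (code v) = sum (weight T) (descendants T v)"
proof (induction rule: vertex_induct)
  case (step v)
  have "sum (weight T) (descendants T v) =
      weight T v + sum (weight T) (\<Union>c\<in>children T v. descendants T c)"
    using finite_children finite_descendants children_verts self_notin_descendants
    by (subst descendants_eq, subst sum.insert) auto
  also have "sum (weight T) (\<Union>c\<in>children T v. descendants T c) =
      (\<Sum>c\<in>children T v. sum (weight T) (descendants T c))"
    using finite_children finite_descendants children_verts descendants_disjoint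
    by (intro sum.UNION_disjoint) blast+
  also have "\<dots> = (\<Sum>c\<in>children T v. wsize (code c))" using step.IH by simp
  finally show ?case by (subst code_eq) (simp add: sum_unfold_sum_mset image_mset.compositionality o_def)
qed

lemma wsize_code_root: "wsize (code (root T)) = total_weight T"
  by (simp add: wsize_code root_in descendants_root total_weight_def)

lemma has_wlimb_code:
  "v \<in> verts T \<Longrightarrow> has_wlimb K (code v) \<longleftrightarrow> (\<exists>w\<in>descendants T v. limb_at_root K (code w))"
proof (induction rule: vertex_induct)
  case (step v)
  have "has_wlimb K (code v) \<longleftrightarrow> limb_at_root K (code v) \<or> (\<exists>c\<in>children T v. has_wlimb K (code c))"
    by (subst has_wlimb_iff, subst (2) code_eq) (simp add: finite_children)
  then show ?case using step.IH by (subst descendants_eq) auto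
qed

end

section \<open>Codes classify trees up to isomorphism\<close>

definition wcode :: "'v wrtree \<Rightarrow> wtree" where
  "wcode T = weighted_tree.code T (root T)"

text \<open>The map carries the children of \<open>v\<close> bijectively onto those of
  \<open>f v\<close>, so the codes agree by induction from the leaves.\<close>

lemma code_cong_iso:
  assumes S: "weighted_rooted_tree S" and T: "weighted_rooted_tree T"
    and f: "bij_betw f (verts S) (verts T)"
    and e: "\<And>u v. u \<in> verts S \<Longrightarrow> v \<in> verts S \<Longrightarrow> (u, v) \<in> edges S \<longleftrightarrow> (f u, f v) \<in> edges T"
    and w: "\<And>v. v \<in> verts S \<Longrightarrow> weight T (f v) = weight S v"
    and v: "v \<in> verts S"
  shows "weighted_tree.code T (f v) = weighted_tree.code S v"
proof -
  interpret S: weighted_tree S using S by unfold_locales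
  interpret T: weighted_tree T using T by unfold_locales
  show ?thesis using v
  proof (induction rule: S.vertex_induct)
    case (step v)
    have "children T (f v) = f ` children S v"
    proof (intro equalityI subsetI)
      fix d assume d: "d \<in> children T (f v)"
      then obtain c where "c \<in> verts S" "d = f c"
        using T.children_verts[of "f v"] f unfolding bij_betw_def by blast
      then show "d \<in> f ` children S v" using d e[OF step.hyps] by (auto simp: children_def)
    next
      fix d assume "d \<in> f ` children S v"
      then show "d \<in> children T (f v)"
        using e[OF step.hyps] S.children_verts by (auto simp: children_def)
    qed
    moreover have "inj_on f (children S v)"
      using f S.children_verts by (meson bij_betw_imp_inj_on inj_on_subset)
    ultimately have "image_mset T.code (mset_set (children T (f v))) =
        image_mset (T.code \<circ> f) (mset_set (children S v))"
      by (simp add: image_mset_mset_set[symmetric] image_mset.compositionality)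
    also have "\<dots> = image_mset S.code (mset_set (children S v))"
      using step.IH by (intro image_mset_cong) (auto simp: S.finite_children)
    finally show ?case using w step.hyps by (subst T.code_eq, subst S.code_eq) simp
  qed
qed

text \<open>The relation \<open>isomorphic\<close> localised to the subtrees at two vertices, so
  that isomorphisms can be built by induction over vertices.\<close>

definition subtree_iso :: "'v wrtree \<Rightarrow> 'v \<Rightarrow> 'w wrtree \<Rightarrow> 'w \<Rightarrow> ('v \<Rightarrow> 'w) \<Rightarrow> bool" where
  "subtree_iso S v T v' f \<longleftrightarrow> bij_betw f (descendants S v) (descendants T v') \<and> f v = v' \<and>
    (\<forall>x\<in>descendants S v. \<forall>y\<in>descendants S v. (x, y) \<in> edges S \<longleftrightarrow> (f x, f y) \<in> edges T) \<and>
    (\<forall>x\<in>descendants S v. weight T (f x) = weight S x)"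

text \<open>Equal codes give a bijection \<open>h\<close> of children preserving codes. The
  isomorphisms obtained inductively below matched children are glued together, with \<open>v\<close>
  sent to \<open>v'\<close>.\<close>

lemma iso_of_code_eq:
  assumes S: "weighted_rooted_tree S" and T: "weighted_rooted_tree T"
    and "v \<in> verts S" "v' \<in> verts T" "weighted_tree.code S v = weighted_tree.code T v'"
  shows "\<exists>f. subtree_iso S v T v' f"
proof -
  interpret S: weighted_tree S using S by unfold_locales
  interpret T: weighted_tree T using T by unfold_locales
  show ?thesis using assms(3-5)
  proof (induction arbitrary: v' rule: S.vertex_induct)
    case (step v)
    have codes: "weight S v = weight T v'"
      "image_mset S.code (mset_set (children S v)) = image_mset T.code (mset_set (children T v'))"
      using step.prems(2) unfolding S.code_eq[of v] T.code_eq[of v'] by auto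
    obtain h where h: "bij_betw h (children S v) (children T v')"
      "\<forall>c\<in>children S v. T.code (h c) = S.code c"
      using ex_bij_betw_same_image_mset[OF S.finite_children T.finite_children codes(2)] by blast
    have hT: "h c \<in> children T v'" if "c \<in> children S v" for c
      using h(1) that by (rule bij_betw_apply)
    have "\<exists>f. subtree_iso S c T (h c) f" if c: "c \<in> children S v" for c
    proof (rule step.IH[OF c])
      show "h c \<in> verts T" using hT[OF c] T.children_verts by blast
      show "S.code c = T.code (h c)" using h(2) c by simp
    qed
    then have "\<forall>c\<in>children S v. \<exists>f. subtree_iso S c T (h c) f" by blast
    from bchoice[OF this] obtain F
      where F0: "\<And>c. c \<in> children S v \<Longrightarrow> subtree_iso S c T (h c) (F c)" by blast
    have F: "\<And>c. c \<in> children S v \<Longrightarrow> bij_betw (F c) (descendants S c) (descendants T (h c))"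
      "\<And>c. c \<in> children S v \<Longrightarrow> F c c = h c"
      "\<And>c x y. c \<in> children S v \<Longrightarrow> x \<in> descendants S c \<Longrightarrow> y \<in> descendants S c \<Longrightarrow>
        (x, y) \<in> edges S \<longleftrightarrow> (F c x, F c y) \<in> edges T"
      "\<And>c x. c \<in> children S v \<Longrightarrow> x \<in> descendants S c \<Longrightarrow> weight T (F c x) = weight S x"
      using F0 unfolding subtree_iso_def by blast+
    \<comment> \<open>The child selected by \<open>THE\<close> is unique because the subtrees below
      distinct children are disjoint.\<close>
    define f where "f = (\<lambda>x. if x = v then v' else F (THE c. c \<in> children S v \<and> x \<in> descendants S c) x)"
    have f_v: "f v = v'" by (simp add: f_def)
    have f_c: "f x = F c x" if "c \<in> children S v" "x \<in> descendants S c" for c x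
    proof -
      have "(THE c. c \<in> children S v \<and> x \<in> descendants S c) = c"
        using that S.descendants_disjoint by (intro the_equality) blast+
      moreover have "x \<noteq> v" using that S.self_notin_descendants by blast
      ultimately show ?thesis by (simp add: f_def)
    qed
    have f_mem: "f x \<in> descendants T (h c)" if "c \<in> children S v" "x \<in> descendants S c" for c x
      using F(1)[OF that(1)] that f_c by (auto dest: bij_betw_apply)
    have f_ne: "f x \<noteq> v'" if "c \<in> children S v" "x \<in> descendants S c" for c x
      using f_mem[OF that] T.self_notin_descendants[OF hT[OF that(1)]] by metis
    have inj_h: "c = c'" if "c \<in> children S v" "c' \<in> children S v" "h c = h c'" for c c'
      using h(1) that by (meson bij_betw_imp_inj_on inj_onD)
    have cases_S: "x = v \<or> (\<exists>c\<in>children S v. x \<in> descendants S c)" if "x \<in> descendants S v" for x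
      using S.descendants_cases[OF that] by blast
    have inj: "inj_on f (descendants S v)"
    proof (rule inj_onI)
      fix x y assume xy: "x \<in> descendants S v" "y \<in> descendants S v" "f x = f y"
      consider "x = v" "y = v" | "x = v" "y \<noteq> v" | "x \<noteq> v" "y = v" | "x \<noteq> v" "y \<noteq> v" by blast
      then show "x = y"
      proof cases
        case 4
        then obtain c where c: "c \<in> children S v" "x \<in> descendants S c"
          using cases_S[OF xy(1)] by blast
        obtain c' where c': "c' \<in> children S v" "y \<in> descendants S c'"
          using 4 cases_S[OF xy(2)] by blast
        have "h c = h c'" using T.descendants_disjoint[OF hT[OF c(1)] hT[OF c'(1)]] f_mem[OF c] f_mem[OF c'] xy by auto
        then have "c = c'" using inj_h c c' by blast
        then have "F c x = F c y" using f_c c c' xy by metis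
        then show ?thesis
          using inj_onD[OF bij_betw_imp_inj_on[OF F(1)[OF c(1)]]] c(2) c'(2) \<open>c = c'\<close> by blast
      qed (use xy f_v f_ne cases_S in \<open>metis+\<close>)
    qed
    have img: "f ` descendants S v = descendants T v'"
    proof (intro equalityI subsetI)
      fix y assume "y \<in> f ` descendants S v"
      then obtain x where x: "x \<in> descendants S v" "y = f x" by blast
      then show "y \<in> descendants T v'"
        using cases_S[OF x(1)] f_v T.descendants_self T.descendants_child[OF hT f_mem] by metis
    next
      fix y assume "y \<in> descendants T v'"
      then consider "y = v'" | d where "d \<in> children T v'" "y \<in> descendants T d"
        by (rule T.descendants_cases)
      then show "y \<in> f ` descendants S v"
      proof cases
        case 1
        then show ?thesis using f_v S.descendants_self by blast
      next
        case 2
        then obtain c where c: "c \<in> children S v" "d = h c" using h(1) by (auto simp: bij_betw_def)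
        then obtain x where "x \<in> descendants S c" "y = F c x"
          using F(1)[OF c(1)] 2(2) c(2) unfolding bij_betw_def by blast
        then show ?thesis using f_c[OF c(1)] S.descendants_child[OF c(1)] by (metis imageI)
      qed
    qed
    have edg: "(x, y) \<in> edges S \<longleftrightarrow> (f x, f y) \<in> edges T"
      if x: "x \<in> descendants S v" and y: "y \<in> descendants S v" for x y
    proof (cases "y = v")
      case True
      have "(x, v) \<notin> edges S" using x S.no_loop by (auto simp: descendants_def)
      moreover have "(f x, v') \<notin> edges T" using x img T.no_loop by (auto simp: descendants_def)
      ultimately show ?thesis using True f_v by simp
    next
      case False
      then obtain c where c: "c \<in> children S v" "y \<in> descendants S c" using cases_S[OF y] by blast
      show ?thesis
      proof (cases "x \<in> descendants S c")
        case True
        then show ?thesis using F(3) f_c c by simp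
      next
        case xnot: False
        \<comment> \<open>The only edge entering the subtree at \<open>c\<close> from outside goes
          from \<open>v\<close> to \<open>c\<close>. The same argument in \<open>T\<close> then
          shows that \<open>f\<close> respects edges between different parts.\<close>
        have edge_S: "(x, y) \<in> edges S \<longleftrightarrow> x = v \<and> y = c"
        proof
          assume xy: "(x, y) \<in> edges S"
          have "y = c"
          proof (rule ccontr)
            assume "y \<noteq> c"
            then obtain p where p: "(c, p) \<in> (edges S)\<^sup>*" "(p, y) \<in> edges S"
              using c(2) unfolding descendants_def by (blast elim: rtranclE)
            then show False using S.parent_unique[OF xy p(2)] xnot by (simp add: descendants_def)
          qed
          then show "x = v \<and> y = c" using S.parent_unique[OF xy, of v] c(1) by (simp add: children_def)
        qed (use c in \<open>auto simp: children_def\<close>)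
        have fy: "f y \<in> descendants T (h c)" using f_mem c by blast
        have fx: "f x \<notin> descendants T (h c)"
        proof
          assume "f x \<in> descendants T (h c)"
          moreover have "F c ` descendants S c = descendants T (h c)"
            using F(1)[OF c(1)] by (simp add: bij_betw_def)
          ultimately obtain z where "z \<in> descendants S c" "f x = F c z" by blast
          then have "f x = f z" "z \<in> descendants S v"
            using f_c[OF c(1)] S.descendants_child[OF c(1)] by simp_all
          then have "x = z" using inj_onD[OF inj] x by blast
          then show False using xnot \<open>z \<in> descendants S c\<close> by simp
        qed
        have "(f x, f y) \<in> edges T \<longleftrightarrow> f x = v' \<and> f y = h c"
        proof
          assume xy: "(f x, f y) \<in> edges T"
          have "f y = h c"
          proof (rule ccontr)
            assume "f y \<noteq> h c"
            then obtain p where p: "(h c, p) \<in> (edges T)\<^sup>*" "(p, f y) \<in> edges T"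
              using fy unfolding descendants_def mem_Collect_eq by (metis rtranclE)
            then show False using T.parent_unique[OF xy p(2)] fx by (simp add: descendants_def)
          qed
          then show "f x = v' \<and> f y = h c"
            using T.parent_unique[OF xy, of v'] hT[OF c(1)] by (simp add: children_def)
        qed (use hT[OF c(1)] in \<open>auto simp: children_def\<close>)
        also have "f x = v' \<longleftrightarrow> x = v"
          using inj_onD[OF inj _ x S.descendants_self] f_v by metis
        also have "f y = h c \<longleftrightarrow> y = c"
          using inj_onD[OF inj _ y S.descendants_child[OF c(1) S.descendants_self]]
            f_c[OF c(1) S.descendants_self] F(2)[OF c(1)] by metis
        finally show ?thesis using edge_S by simp
      qed
    qed
    have "weight T (f x) = weight S x" if "x \<in> descendants S v" for x
      using cases_S[OF that] f_v codes(1) f_c F(4) by metis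
    then have "subtree_iso S v T v' f"
      unfolding subtree_iso_def bij_betw_def using inj img edg f_v by blast
    then show ?case by blast
  qed
qed

lemma isomorphic_iff_wcode:
  assumes "weighted_rooted_tree S" "weighted_rooted_tree T"
  shows "isomorphic S T \<longleftrightarrow> wcode S = wcode T"
proof
  interpret S: weighted_tree S using assms by unfold_locales
  interpret T: weighted_tree T using assms by unfold_locales
  {
    assume "isomorphic S T"
    then obtain f where "bij_betw f (verts S) (verts T)" "f (root S) = root T"
      "\<And>u v. u \<in> verts S \<Longrightarrow> v \<in> verts S \<Longrightarrow> (u, v) \<in> edges S \<longleftrightarrow> (f u, f v) \<in> edges T"
      "\<And>v. v \<in> verts S \<Longrightarrow> weight T (f v) = weight S v"
      unfolding isomorphic_def by blast
    then show "wcode S = wcode T"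
      using code_cong_iso[OF assms, of f "root S"] S.root_in by (simp add: wcode_def)
  next
    assume "wcode S = wcode T"
    then show "isomorphic S T"
      using iso_of_code_eq[OF assms S.root_in T.root_in]
      unfolding wcode_def isomorphic_def subtree_iso_def S.descendants_root T.descendants_root
      by blast
  }
qed

section \<open>Limbs expressed through codes\<close>

context weighted_tree
begin

text \<open>No edge enters \<open>v\<close> from the limb, and sets of descendants are closed under
  edges, so no edge joins two branches away from \<open>v\<close>. The union of the branches is
  therefore an induced subgraph.\<close>

lemma limb_alt:
  assumes "v \<in> verts T" "C \<subseteq> children T v"
  shows "limb T v C = (let V = insert v (\<Union>c\<in>C. descendants T c) in
    \<lparr>verts = V, edges = edges T \<inter> V \<times> V, root = v, weight = weight T\<rparr>)"
proof -
  let ?V = "insert v (\<Union>c\<in>C. descendants T c)"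
  have "(\<Union>c\<in>C. edges T \<inter> insert v (descendants T c) \<times> insert v (descendants T c)) = edges T \<inter> ?V \<times> ?V"
  proof (intro equalityI subsetI)
    fix e assume "e \<in> edges T \<inter> ?V \<times> ?V"
    then obtain x y where e: "e = (x, y)" "(x, y) \<in> edges T" "x \<in> ?V" "y \<in> ?V" by (cases e) auto
    have "y \<noteq> v"
    proof
      assume "y = v"
      have "x \<in> descendants T v" using e(3) assms(2) descendants_child descendants_self by blast
      then show False using e(2) \<open>y = v\<close> no_loop by (auto simp: descendants_def)
    qed
    then obtain c where c: "c \<in> C" "y \<in> descendants T c" using e by blast
    show "e \<in> (\<Union>c\<in>C. edges T \<inter> insert v (descendants T c) \<times> insert v (descendants T c))"
    proof (cases "x = v")
      case True
      then show ?thesis using c e by blast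
    next
      case False
      then obtain c' where "c' \<in> C" "x \<in> descendants T c'" using e by blast
      then show ?thesis using e descendants_step[of x c' y] by blast
    qed
  qed blast
  moreover have "insert v (\<Union>c\<in>C. insert v (descendants T c)) = ?V" by blast
  ultimately show ?thesis
    unfolding limb_def branch_def Let_def by (simp only: wrtree.select_convs)
qed

lemma limb_wrt:
  assumes v: "v \<in> verts T" and C: "C \<subseteq> children T v"
  shows "weighted_rooted_tree (limb T v C)"
proof -
  define V where "V = insert v (\<Union>c\<in>C. descendants T c)"
  have V_desc: "V \<subseteq> descendants T v"
    using C descendants_child descendants_self by (auto simp: V_def)
  then have V_verts: "V \<subseteq> verts T" using descendants_verts[OF v] by blast
  have v_top: "(x, v) \<notin> edges T" if "x \<in> V" for x
    using V_desc that no_loop by (auto simp: descendants_def)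
  \<comment> \<open>Closure under parents, except at \<open>v\<close>, carries both parent
    uniqueness and the paths starting at \<open>v\<close> over from \<open>T\<close> to the
    limb.\<close>
  have parent: "p \<in> V" if x: "(p, x) \<in> edges T" "x \<in> V" "x \<noteq> v" for p x
  proof -
    obtain c where c: "c \<in> C" "x \<in> descendants T c" using x by (auto simp: V_def)
    show ?thesis
    proof (cases "x = c")
      case True
      then have "p = v" using parent_unique[OF x(1), of v] c C by (auto simp: children_def)
      then show ?thesis by (simp add: V_def)
    next
      case False
      then obtain q where q: "(c, q) \<in> (edges T)\<^sup>*" "(q, x) \<in> edges T"
        using c(2) unfolding descendants_def by (blast elim: rtranclE)
      then show ?thesis using parent_unique[OF x(1) q(2)] c(1) by (auto simp: V_def descendants_def)
    qed
  qed
  have reach: "x \<in> V \<Longrightarrow> (v, x) \<in> (edges T \<inter> V \<times> V)\<^sup>*" if "(v, x) \<in> (edges T)\<^sup>*" for x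
    using that
  proof (induction rule: rtrancl_induct)
    case (step y z)
    show ?case
    proof (cases "z = v")
      case False
      then have "y \<in> V" using parent step by blast
      then show ?thesis using step by (meson IntI SigmaI rtrancl.rtrancl_into_rtrancl)
    qed simp
  qed simp
  have uniq: "\<exists>!u. (u, x) \<in> edges T \<inter> V \<times> V" if x: "x \<in> V" "x \<noteq> v" for x
  proof -
    have "x \<noteq> root T"
    proof
      assume "x = root T"
      have "(v, x) \<in> (edges T)\<^sup>*" using x V_desc by (auto simp: descendants_def)
      then show False using x no_parent_root \<open>x = root T\<close> by (metis rtranclE)
    qed
    then obtain u where u: "(u, x) \<in> edges T" using ex1_parent[of x] x V_verts by blast
    then have "(u, x) \<in> edges T \<inter> V \<times> V" using parent x by blast
    then show ?thesis using parent_unique[OF u] by blast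
  qed
  have "v \<in> V" by (simp add: V_def)
  have reach': "(v, x) \<in> (edges T \<inter> V \<times> V)\<^sup>*" if "x \<in> V" for x
    using reach[of x] that V_desc by (auto simp: descendants_def)
  show ?thesis
    unfolding limb_alt[OF v C] V_def[symmetric] weighted_rooted_tree_def Let_def wrtree.select_convs
  proof (intro conjI ballI allI)
    show "finite V" by (rule finite_subset[OF V_verts finite_verts])
    show "\<exists>!u. (u, x) \<in> edges T \<inter> V \<times> V" if "x \<in> V - {v}" for x using uniq that by blast
    show "0 < weight T x" if "x \<in> V" for x using weight_pos that V_verts by blast
  qed (use v_top reach' \<open>v \<in> V\<close> in blast)+
qed

text \<open>Below the chosen children the limb has the same edges as \<open>T\<close>, so codes
  there are unchanged; only \<open>v\<close> loses children.\<close>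

lemma wcode_limb:
  assumes v: "v \<in> verts T" and C: "C \<subseteq> children T v"
  shows "wcode (limb T v C) = Node (weight T v) (image_mset code (mset_set C))"
proof -
  interpret K: weighted_tree "limb T v C" using limb_wrt[OF assms] by unfold_locales
  define V where "V = insert v (\<Union>c\<in>C. descendants T c)"
  have limb: "limb T v C = \<lparr>verts = V, edges = edges T \<inter> V \<times> V, root = v, weight = weight T\<rparr>"
    using limb_alt[OF assms] by (simp add: V_def Let_def)
  have ch: "children (limb T v C) x = children T x" if "c \<in> C" "x \<in> descendants T c" for c x
    using that descendants_step[OF that(2)] by (auto simp: limb children_def V_def)
  have code_c: "K.code x = code x" if "c \<in> C" "x \<in> descendants T c" for c x
  proof -
    have "x \<in> verts T" using that C children_verts descendants_verts by blast
    then show ?thesis using that(2)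
    proof (induction rule: vertex_induct)
      case (step x)
      have "K.code d = code d" if "d \<in> children T x" for d
        using step that descendants_step by (auto simp: children_def)
      then have "image_mset K.code (mset_set (children T x)) = image_mset code (mset_set (children T x))"
        by (intro image_mset_cong) (auto simp: finite_children)
      then show ?case using ch[OF \<open>c \<in> C\<close> step.prems]
        by (subst K.code_eq, subst code_eq) (simp add: limb)
    qed
  qed
  have "children (limb T v C) v = C"
  proof (intro equalityI subsetI)
    fix d assume "d \<in> children (limb T v C) v"
    then have d: "d \<in> children T v" "d \<in> V" by (auto simp: limb children_def)
    then have "d \<noteq> v" using self_notin_descendants descendants_self by blast
    then obtain c where "c \<in> C" "d \<in> descendants T c" using d by (auto simp: V_def)
    then show "d \<in> C" using descendants_disjoint[OF d(1)] C descendants_self by blast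
  qed (use C descendants_self in \<open>auto simp: limb children_def V_def\<close>)
  moreover have "image_mset K.code (mset_set C) = image_mset code (mset_set C)"
    using code_c descendants_self finite_subset[OF C finite_children]
    by (intro image_mset_cong) auto
  ultimately show ?thesis
    unfolding wcode_def by (subst K.code_eq) (simp add: limb)
qed

text \<open>At each vertex, isomorphism with \<open>L\<close> is equality of codes, and choosing a
  set of children is choosing a sub-multiset of child codes. All vertices are descendants of the
  root.\<close>

lemma has_limb_iff:
  assumes L: "weighted_rooted_tree L"
  shows "has_limb T L \<longleftrightarrow> has_wlimb (wcode L) (wcode T)"
proof -
  have "(\<exists>C\<subseteq>children T v. isomorphic (limb T v C) L) \<longleftrightarrow> limb_at_root (wcode L) (code v)"
    if v: "v \<in> verts T" for v
  proof -
    have "(\<exists>C\<subseteq>children T v. isomorphic (limb T v C) L) \<longleftrightarrow>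
      (\<exists>C\<subseteq>children T v. Node (weight T v) (image_mset code (mset_set C)) = wcode L)"
      using isomorphic_iff_wcode[OF limb_wrt[OF v] L] wcode_limb[OF v] by auto
    also have "\<dots> \<longleftrightarrow> weight T v = root_weight (wcode L) \<and>
        (\<exists>C\<subseteq>children T v. image_mset code (mset_set C) = subtrees (wcode L))"
      by (cases "wcode L") auto
    also have "\<dots> \<longleftrightarrow> limb_at_root (wcode L) (code v)"
      unfolding subset_image_mset_iff[OF finite_children, symmetric] limb_at_root_def
      by (simp add: code_eq[of v])
    finally show ?thesis .
  qed
  then show ?thesis
    unfolding has_limb_def wcode_def using has_wlimb_code[OF root_in] descendants_root by auto
qed

end

section \<open>Realising codes and counting isomorphism classes\<close>

text \<open>Realisations of the subtrees are placed disjointly below a new root.\<close>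

lemma ex_wrtree_of_code:
  assumes "pos_weights t"
  shows "\<exists>T :: nat wrtree. weighted_rooted_tree T \<and> wcode T = t"
  using assms
proof (induction t)
  case (Node k M)
  \<comment> \<open>List positions distinguish equal subtrees, each of which needs its own
    copy.\<close>
  obtain ts where ts: "mset ts = M" using ex_mset by blast
  have "\<forall>i<length ts. \<exists>T :: nat wrtree. weighted_rooted_tree T \<and> wcode T = ts ! i"
    using Node ts by auto
  then obtain F :: "nat \<Rightarrow> nat wrtree" where
    F: "\<And>i. i < length ts \<Longrightarrow> weighted_rooted_tree (F i)" "\<And>i. i < length ts \<Longrightarrow> wcode (F i) = ts ! i"
    by metis
  define n where "n = length ts"
  have Fi: "weighted_tree (F i)" if "i < n" for i using F that by (simp add: weighted_tree_def n_def)
  \<comment> \<open>Vertex \<open>v\<close> of copy \<open>i\<close>; the successor keeps 0 free for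
    the new root.\<close>
  define enc where "enc = (\<lambda>i v. Suc (prod_encode (i, v)))"
  have enc_eq [simp]: "enc i v = enc j w \<longleftrightarrow> i = j \<and> v = w" for i v j w by (simp add: enc_def)
  have enc_0 [simp]: "enc i v \<noteq> 0" "0 \<noteq> enc i v" for i v by (simp_all add: enc_def)
  define E where "E = {(0, enc i (root (F i))) |i. i < n} \<union> {(enc i u, enc i v) |i u v. i < n \<and> (u, v) \<in> edges (F i)}"
  define V where "V = insert 0 (\<Union>i<n. enc i ` verts (F i))"
  define T :: "nat wrtree" where "T = \<lparr>verts = V, edges = E, root = 0,
    weight = (\<lambda>x. if x = 0 then k else (let (i, v) = prod_decode (x - 1) in weight (F i) v))\<rparr>"
  have T_sel: "verts T = V" "edges T = E" "root T = 0" "weight T 0 = k"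
    "weight T (enc i v) = weight (F i) v" for i v
    by (auto simp: T_def enc_def)
  have E_0: "(0, y) \<in> E \<longleftrightarrow> (\<exists>i<n. y = enc i (root (F i)))" for y by (auto simp: E_def)
  have E_enc: "(enc i u, y) \<in> E \<longleftrightarrow> i < n \<and> (\<exists>v. y = enc i v \<and> (u, v) \<in> edges (F i))" for i u y
    by (auto simp: E_def)
  have E_to: "(x, enc i v) \<in> E \<longleftrightarrow> i < n \<and> (x = 0 \<and> v = root (F i) \<or> (\<exists>u. x = enc i u \<and> (u, v) \<in> edges (F i)))" for i v x
    by (auto simp: E_def)
  have reach: "(0, enc i v) \<in> E\<^sup>*" if "i < n" "v \<in> verts (F i)" for i v
  proof -
    have "(root (F i), v) \<in> (edges (F i))\<^sup>*" using weighted_tree.reachable[OF Fi] that by blast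
    then show ?thesis
    proof (induction rule: rtrancl_induct)
      case base
      show ?case using that E_0 by blast
    next
      case (step y z)
      then have "(enc i y, enc i z) \<in> E" using that E_enc by blast
      then show ?case using step.IH by (rule rtrancl.rtrancl_into_rtrancl[rotated])
    qed
  qed
  have "weighted_rooted_tree T"
    unfolding weighted_rooted_tree_def T_sel
  proof (intro conjI ballI allI)
    show "finite V" using weighted_tree.finite_verts[OF Fi] by (auto simp: V_def)
    show "0 \<in> V" by (simp add: V_def)
    show "E \<subseteq> V \<times> V"
      using weighted_tree.edges_sub[OF Fi] weighted_tree.root_in[OF Fi] by (fastforce simp: E_def V_def)
    show "(u, 0) \<notin> E" for u by (auto simp: E_def)
    fix x assume x: "x \<in> V"
    show "(0, x) \<in> E\<^sup>*" using x reach by (auto simp: V_def)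
    show "0 < weight T x" using x Node.prems weighted_tree.weight_pos[OF Fi] T_sel by (auto simp: V_def)
  next
    fix x assume "x \<in> V - {0}"
    then obtain i v where x: "x = enc i v" "i < n" "v \<in> verts (F i)" by (auto simp: V_def)
    show "\<exists>!u. (u, x) \<in> E"
    proof (cases "v = root (F i)")
      case True
      then show ?thesis using x weighted_tree.no_parent_root[OF Fi[OF x(2)]] by (auto simp: E_to)
    next
      case False
      then have "\<exists>!u. (u, v) \<in> edges (F i)" using weighted_tree.ex1_parent[OF Fi] x by blast
      then show ?thesis using x False by (auto simp: E_to)
    qed
  qed
  then interpret T: weighted_tree T by unfold_locales
  have code_enc: "T.code (enc i v) = weighted_tree.code (F i) v" if i: "i < n" and v: "v \<in> verts (F i)" for i v
  proof -
    interpret Fi: weighted_tree "F i" using Fi[OF i] .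
    show ?thesis using v
    proof (induction rule: Fi.vertex_induct)
      case (step v)
      have "children T (enc i v) = enc i ` children (F i) v"
        using i by (auto simp: children_def T_sel E_enc)
      moreover have "inj_on (enc i) (children (F i) v)" by (simp add: inj_on_def)
      ultimately have "image_mset T.code (mset_set (children T (enc i v))) =
          image_mset (T.code \<circ> enc i) (mset_set (children (F i) v))"
        by (simp add: image_mset_mset_set[symmetric] image_mset.compositionality)
      also have "\<dots> = image_mset Fi.code (mset_set (children (F i) v))"
        using step.IH by (intro image_mset_cong) (auto simp: Fi.finite_children)
      finally show ?case by (subst T.code_eq, subst Fi.code_eq) (simp add: T_sel)
    qed
  qed
  define r where "r = (\<lambda>i. enc i (root (F i)))"
  have "children T 0 = r ` {..<n}" by (auto simp: children_def T_sel E_0 r_def)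
  moreover have "inj_on r {..<n}" by (simp add: inj_on_def r_def)
  ultimately have "image_mset T.code (mset_set (children T 0)) = image_mset (T.code \<circ> r) (mset_set {..<n})"
    by (simp add: image_mset_mset_set[symmetric] image_mset.compositionality)
  also have "\<dots> = image_mset (\<lambda>i. ts ! i) (mset_set {..<n})"
    using code_enc weighted_tree.root_in[OF Fi] F(2)
    by (intro image_mset_cong) (auto simp: r_def wcode_def n_def)
  also have "\<dots> = M"
    unfolding ts[symmetric] n_def
    by (metis atLeast0LessThan map_nth mset_map mset_upt)
  finally have "wcode T = Node k M"
    unfolding wcode_def T_sel by (subst T.code_eq) (simp add: T_sel)
  then show ?case using T.wrt by blast
qed

lemma card_iso_classes:
  assumes "\<And>T. weighted_rooted_tree T \<Longrightarrow> P T \<longleftrightarrow> Q (wcode T)"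
  shows "card ({T \<in> trees_of_weight n. P T} // iso_rel) = card {t. pos_weights t \<and> Q t \<and> wsize t = n}"
proof -
  define A where "A = {T \<in> trees_of_weight n. P T}"
  have wcode_props: "pos_weights (wcode T)" "wsize (wcode T) = total_weight T"
    if "weighted_rooted_tree T" for T :: "nat wrtree"
  proof -
    interpret weighted_tree T using that by unfold_locales
    show "pos_weights (wcode T)" "wsize (wcode T) = total_weight T"
      using pos_weights_code[OF root_in] wsize_code_root by (simp_all add: wcode_def)
  qed
  have iso: "isomorphic S T \<longleftrightarrow> wcode S = wcode T"
    if "weighted_rooted_tree S" "weighted_rooted_tree T" for S T :: "nat wrtree"
    using that by (rule isomorphic_iff_wcode)
  have cls: "iso_rel `` {T} = {S. weighted_rooted_tree S \<and> wcode S = wcode T}" if "T \<in> A" for T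
    using that iso by (auto simp: iso_rel_def A_def trees_of_weight_def)
  have "A // iso_rel = (\<lambda>t. {S. weighted_rooted_tree S \<and> wcode S = t}) ` wcode ` A"
    unfolding quotient_def using cls by auto
  moreover have "inj_on (\<lambda>t. {S :: nat wrtree. weighted_rooted_tree S \<and> wcode S = t}) (wcode ` A)"
    by (rule inj_onI) (auto simp: A_def trees_of_weight_def set_eq_iff)
  moreover have "wcode ` A = {t. pos_weights t \<and> Q t \<and> wsize t = n}"
  proof (intro equalityI subsetI)
    fix t assume "t \<in> {t. pos_weights t \<and> Q t \<and> wsize t = n}"
    moreover from this obtain T :: "nat wrtree" where "weighted_rooted_tree T" "wcode T = t"
      using ex_wrtree_of_code by blast
    ultimately show "t \<in> wcode ` A"
      using wcode_props assms by (auto simp: A_def trees_of_weight_def)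
  qed (use wcode_props assms in \<open>auto simp: A_def trees_of_weight_def\<close>)
  ultimately show ?thesis by (simp add: A_def card_image)
qed

theorem corollary2p5:
  fixes L :: "'v wrtree"
  assumes "weighted_rooted_tree L"
  shows "limb_proportion L \<longlonglongrightarrow> 1"
proof -
  interpret L: weighted_tree L using assms by unfold_locales
  interpret positive_limb "wcode L"
    by unfold_locales (simp add: wcode_def L.pos_weights_code L.root_in)
  have "card ({T \<in> trees_of_weight n. has_limb T L} // iso_rel) =
      card {t. pos_weights t \<and> has_wlimb (wcode L) t \<and> wsize t = n}" for n
    by (rule card_iso_classes) (simp add: weighted_tree.has_limb_iff[OF _ assms] weighted_tree_def)
  moreover have "card (trees_of_weight n // iso_rel) = card {t. pos_weights t \<and> wsize t = n}" for n
    using card_iso_classes[of "\<lambda>_. True" "\<lambda>_. True" n] by simp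
  ultimately show ?thesis
    unfolding limb_proportion_def using wtree_limb_proportion by simp
qed

end
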